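(* Let $n\ge0$ and let $(\gamma_\alpha)_\alpha$ be a family of nonnegative real numbers indexed by the compositions $\alpha$ of $n$. Let $\mathbb{k}$ be an ordered field of characteristic $0$ containing the numbers $\gamma_\alpha$ (e.g. $\mathbb{k}=\mathbb{R}$). Put $B_\gamma=\sum_\alpha\gamma_\alpha B_\alpha\in\mathbb{k}S_n$ and $\widetilde{n}_\gamma(F)=\sum_\alpha\gamma_\alpha\widetilde{n}_\alpha(F)$ for $F\in\Sigma_n$. Then the minimal polynomial of $w_0B_\gamma$ in $\mathbb{k}S_n$ is \[ \prod_{k\in\widetilde{n}_\gamma(\Sigma_n)}(x-k), \] where $\widetilde{n}_\gamma(\Sigma_n)=\{\widetilde{n}_\gamma(F):F\in\Sigma_n\}$ and the product is over its distinct elements.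
   Context: $[n]=\{1,\ldots,n\}$; $S_n$ the symmetric group with $(\sigma\tau)(i)=\sigma(\tau(i))$, $\mathbb{k}S_n$ its group algebra, $w_0(i)=n+1-i$. For a composition $\alpha=(\alpha_1,\ldots,\alpha_k)$ of $n$ let $D(\alpha)=\{\alpha_1,\ldots,\alpha_1+\cdots+\alpha_{k-1}\}$ and $B_\alpha=\sum_{w\in S_n:\operatorname{Des}w\subseteq D(\alpha)}w$, where $\operatorname{Des}w=\{i\in[n-1]:w(i)>w(i+1)\}$. A set composition of $[n]$ is a tuple $F=(F_1,\ldots,F_m)$ of nonempty pairwise disjoint sets with union $[n]$; $\ell(F)=m$, $\operatorname{type}F=(|F_1|,\ldots,|F_m|)$; $\Sigma_n$ is the set of all of them. $F\preceq G$ means each block of $F$ lies in some block of $G$. $n_\alpha(F)=\#\{G\in\Sigma_n:F\preceq G,\ \operatorname{type}G=\alpha\}$, $\widetilde{n}_\alpha(F)=(-1)^{n-\ell(F)}n_\alpha(F)$. *)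

theory Defs
  imports
    "HOL-Computational_Algebra.Polynomial"
    "HOL-Algebra.Module"
    "HOL-Algebra.Sym_Groups"
begin

text \<open>An element of the group algebra of the symmetric group is represented by its coefficient
  function, which vanishes outside the group; the product is convolution.\<close>

definition sym_algebra :: "nat \<Rightarrow> ('k::field, (nat \<Rightarrow> nat) \<Rightarrow> 'k) module" where
  "sym_algebra n =
    \<lparr> carrier = {a. \<forall>w. w \<notin> carrier (sym_group n) \<longrightarrow> a w = 0},
      mult = (\<lambda>a b w. \<Sum>(u, v) | u \<in> carrier (sym_group n) \<and> v \<in> carrier (sym_group n) \<and>
                                    u \<otimes>\<^bsub>sym_group n\<^esub> v = w. a u * b v),
      one = (\<lambda>w. if w = \<one>\<^bsub>sym_group n\<^esub> then 1 else 0),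
      zero = (\<lambda>w. 0),
      add = (\<lambda>a b w. a w + b w),
      smult = (\<lambda>c a w. c * a w) \<rparr>"

definition perm_elem :: "(nat \<Rightarrow> nat) \<Rightarrow> (nat \<Rightarrow> nat) \<Rightarrow> 'k::field" where
  "perm_elem w = (\<lambda>v. if v = w then 1 else 0)"

definition eval_poly_in :: "('k::field, 'b, 'm) module_scheme \<Rightarrow> 'k poly \<Rightarrow> 'b \<Rightarrow> 'b" where
  "eval_poly_in A p a = (\<Oplus>\<^bsub>A\<^esub>i\<in>{..degree p}. coeff p i \<odot>\<^bsub>A\<^esub> (a [^]\<^bsub>A\<^esub> i))"

definition is_minimal_polynomial ::
    "('k::field, 'b, 'm) module_scheme \<Rightarrow> 'b \<Rightarrow> 'k poly \<Rightarrow> bool" where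
  "is_minimal_polynomial A a p \<longleftrightarrow>
     lead_coeff p = 1 \<and> eval_poly_in A p a = \<zero>\<^bsub>A\<^esub> \<and>
     (\<forall>q. q \<noteq> 0 \<and> eval_poly_in A q a = \<zero>\<^bsub>A\<^esub> \<longrightarrow> degree p \<le> degree q)"

definition compositions :: "nat \<Rightarrow> nat list set" where
  "compositions n = {\<alpha>. (\<forall>a\<in>set \<alpha>. 0 < a) \<and> sum_list \<alpha> = n}"

definition partial_sums :: "nat list \<Rightarrow> nat set" where
  "partial_sums \<alpha> = {sum_list (take j \<alpha>) | j. 1 \<le> j \<and> j < length \<alpha>}"

definition Des :: "nat \<Rightarrow> (nat \<Rightarrow> nat) \<Rightarrow> nat set" where
  "Des n w = {i \<in> {1..n - 1}. w i > w (i + 1)}"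

definition B_comp :: "nat \<Rightarrow> nat list \<Rightarrow> (nat \<Rightarrow> nat) \<Rightarrow> 'k::field" where
  "B_comp n \<alpha> =
     (\<Oplus>\<^bsub>sym_algebra n\<^esub>w \<in> {w \<in> carrier (sym_group n). Des n w \<subseteq> partial_sums \<alpha>}. perm_elem w)"

definition B_family :: "nat \<Rightarrow> (nat list \<Rightarrow> 'k::field) \<Rightarrow> (nat \<Rightarrow> nat) \<Rightarrow> 'k" where
  "B_family n \<gamma> =
     (\<Oplus>\<^bsub>sym_algebra n\<^esub>\<alpha>\<in>compositions n. \<gamma> \<alpha> \<odot>\<^bsub>sym_algebra n\<^esub> B_comp n \<alpha>)"

definition w0 :: "nat \<Rightarrow> nat \<Rightarrow> nat" where
  "w0 n i = (if i \<in> {1..n} then n + 1 - i else i)"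

definition set_compositions :: "nat \<Rightarrow> nat set list set" where
  "set_compositions n = {F. {} \<notin> set F \<and> sorted_wrt disjnt F \<and> \<Union>(set F) = {1..n}}"

definition set_comp_type :: "nat set list \<Rightarrow> nat list" where
  "set_comp_type F = map card F"

definition blocks_refine :: "nat set list \<Rightarrow> nat set list \<Rightarrow> bool"  (infix "\<preceq>\<^sub>b" 50) where
  "F \<preceq>\<^sub>b G \<longleftrightarrow> (\<forall>X\<in>set F. \<exists>Y\<in>set G. X \<subseteq> Y)"

definition n_comp :: "nat \<Rightarrow> nat list \<Rightarrow> nat set list \<Rightarrow> nat" where
  "n_comp n \<alpha> F = card {G \<in> set_compositions n. F \<preceq>\<^sub>b G \<and> set_comp_type G = \<alpha>}"

definition n_tilde_comp :: "nat \<Rightarrow> nat list \<Rightarrow> nat set list \<Rightarrow> 'k::field" where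
  "n_tilde_comp n \<alpha> F = (- 1) ^ (n - length F) * of_nat (n_comp n \<alpha> F)"

definition n_tilde_family :: "nat \<Rightarrow> (nat list \<Rightarrow> 'k::field) \<Rightarrow> nat set list \<Rightarrow> 'k" where
  "n_tilde_family n \<gamma> F = (\<Sum>\<alpha>\<in>compositions n. \<gamma> \<alpha> * n_tilde_comp n \<alpha> F)"

text \<open>The following facts make sure that no sum, cardinality or difference above
  takes a default value.\<close>

lemma finite_compositions: "finite (compositions n)"
proof -
  have "length \<alpha> \<le> sum_list \<alpha>" if "\<forall>a\<in>set \<alpha>. 0 < a" for \<alpha> :: "nat list"
    using that by (induction \<alpha>) auto
  then have "compositions n \<subseteq> {\<alpha>. set \<alpha> \<subseteq> {..n} \<and> length \<alpha> \<le> n}"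
    unfolding compositions_def using member_le_sum_list by fastforce
  then show ?thesis
    using finite_lists_length_le[of "{..n}" n] finite_subset by blast
qed

lemma set_composition_length_le:
  assumes "F \<in> set_compositions n"
  shows "length F \<le> n"
proof -
  have "length F \<le> card (\<Union>(set F))"
    if "{} \<notin> set F" "sorted_wrt disjnt F" "finite (\<Union>(set F))" for F :: "nat set list"
    using that
  proof (induction F)
    case (Cons X F)
    have "X \<inter> \<Union>(set F) = {}" using Cons.prems(2) by (auto simp: disjnt_def)
    moreover have "finite X" "finite (\<Union>(set F))" "X \<noteq> {}" using Cons.prems by auto
    ultimately have "card (\<Union>(set (X # F))) = card X + card (\<Union>(set F))" "0 < card X"
      by (simp_all add: card_Un_disjoint card_gt_0_iff)
    then show ?case using Cons by simp
  qed simp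
  then show ?thesis using assms by (fastforce simp: set_compositions_def)
qed

lemma finite_set_compositions: "finite (set_compositions n)"
proof -
  have "set_compositions n \<subseteq> {F. set F \<subseteq> Pow {1..n} \<and> length F \<le> n}"
    using set_composition_length_le by (auto simp: set_compositions_def)
  then show ?thesis
    using finite_lists_length_le[of "Pow {1..n}" n] finite_subset by blast
qed

lemma w0_in_sym_group: "w0 n \<in> carrier (sym_group n)"
  unfolding sym_group_carrier
proof (rule bij_imp_permutes)
  show "bij_betw (w0 n) {1..n} {1..n}"
    by (rule bij_betwI[where g = "w0 n"]) (auto simp: w0_def)
qed (auto simp: w0_def)

lemma finite_sym_group: "finite (carrier (sym_group n))"
  by (simp add: sym_group_def finite_permutations)

lemma sym_algebra_mult:
  "(a \<otimes>\<^bsub>sym_algebra n\<^esub> b) w =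
     (\<Sum>u\<in>carrier (sym_group n). \<Sum>v\<in>carrier (sym_group n). if u \<circ> v = w then a u * b v else 0)"
proof -
  let ?S = "carrier (sym_group n)"
  have "(a \<otimes>\<^bsub>sym_algebra n\<^esub> b) w = (\<Sum>(u, v) \<in> {x \<in> ?S \<times> ?S. fst x \<circ> snd x = w}. a u * b v)"
    by (auto simp: sym_algebra_def sym_group_mult intro!: sum.cong)
  also have "\<dots> = (\<Sum>x\<in>?S \<times> ?S. if fst x \<circ> snd x = w then a (fst x) * b (snd x) else 0)"
    by (subst sum.inter_filter[symmetric]) (auto simp: finite_sym_group case_prod_beta)
  finally show ?thesis by (simp add: sum.cartesian_product case_prod_beta)
qed

lemma sym_comp_closed:
  "u \<in> carrier (sym_group n) \<Longrightarrow> v \<in> carrier (sym_group n) \<Longrightarrow> u \<circ> v \<in> carrier (sym_group n)"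
  by (simp add: sym_group_carrier permutes_compose)

lemma sym_algebra_ring: "ring (sym_algebra n :: ('k::field, _) module)"
proof (rule ringI)
  let ?A = "sym_algebra n :: ('k, _) module" and ?S = "carrier (sym_group n)"
  have one_S: "id \<in> ?S" by (simp add: sym_group_carrier permutes_id)
  have closed: "a \<otimes>\<^bsub>?A\<^esub> b \<in> carrier ?A" for a b
  proof -
    have "(a \<otimes>\<^bsub>?A\<^esub> b) w = 0" if "w \<notin> ?S" for w
      unfolding sym_algebra_mult using that sym_comp_closed by (intro sum.neutral ballI) auto
    then show ?thesis by (simp add: sym_algebra_def)
  qed
  show "abelian_group ?A"
  proof (rule abelian_groupI)
    fix x assume "x \<in> carrier ?A"
    then show "\<exists>y\<in>carrier ?A. y \<oplus>\<^bsub>?A\<^esub> x = \<zero>\<^bsub>?A\<^esub>"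
      by (intro bexI[of _ "\<lambda>w. - x w"]) (auto simp: sym_algebra_def)
  qed (auto simp: sym_algebra_def algebra_simps)
  show "monoid ?A"
  proof (rule monoidI)
    show "\<one>\<^bsub>?A\<^esub> \<in> carrier ?A"
      using one_S by (auto simp: sym_algebra_def sym_group_one)
    fix a assume a: "a \<in> carrier ?A"
    then have a0: "a w = 0" if "w \<notin> ?S" for w using that by (simp add: sym_algebra_def)
    have one: "\<one>\<^bsub>?A\<^esub> = (\<lambda>w. if w = id then 1 else 0)"
      by (simp add: sym_algebra_def sym_group_one)
    show "\<one>\<^bsub>?A\<^esub> \<otimes>\<^bsub>?A\<^esub> a = a"
    proof
      fix w
      have "(\<one>\<^bsub>?A\<^esub> \<otimes>\<^bsub>?A\<^esub> a) w =
          (\<Sum>u\<in>?S. if u = id then (\<Sum>v\<in>?S. if v = w then a v else 0) else 0)"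
        unfolding sym_algebra_mult one by (intro sum.cong refl) (simp cong: if_cong)
      also have "\<dots> = a w"
        using one_S a0 by (simp add: finite_sym_group)
      finally show "(\<one>\<^bsub>?A\<^esub> \<otimes>\<^bsub>?A\<^esub> a) w = a w" .
    qed
    show "a \<otimes>\<^bsub>?A\<^esub> \<one>\<^bsub>?A\<^esub> = a"
    proof
      fix w
      have "(a \<otimes>\<^bsub>?A\<^esub> \<one>\<^bsub>?A\<^esub>) w =
          (\<Sum>u\<in>?S. \<Sum>v\<in>?S. if v = id then (if u = w then a u else 0) else 0)"
        unfolding sym_algebra_mult one by (intro sum.cong refl) auto
      also have "\<dots> = a w"
        using one_S a0 by (simp add: finite_sym_group)
      finally show "(a \<otimes>\<^bsub>?A\<^esub> \<one>\<^bsub>?A\<^esub>) w = a w" .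
    qed
  next
    fix a b c
    show "a \<otimes>\<^bsub>?A\<^esub> b \<otimes>\<^bsub>?A\<^esub> c = a \<otimes>\<^bsub>?A\<^esub> (b \<otimes>\<^bsub>?A\<^esub> c)"
    proof
      fix w
      have "(a \<otimes>\<^bsub>?A\<^esub> b \<otimes>\<^bsub>?A\<^esub> c) w =
          (\<Sum>x\<in>?S. \<Sum>v\<in>?S. \<Sum>u\<in>?S. \<Sum>t\<in>?S.
             if u \<circ> t = x then (if x \<circ> v = w then a u * b t * c v else 0) else 0)"
        unfolding sym_algebra_mult
        by (intro sum.cong refl) (simp add: sum_distrib_right if_distrib[of "\<lambda>z. z * c v" for v] cong: if_cong)
      also have "\<dots> = (\<Sum>v\<in>?S. \<Sum>u\<in>?S. \<Sum>t\<in>?S. \<Sum>x\<in>?S.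
             if u \<circ> t = x then (if x \<circ> v = w then a u * b t * c v else 0) else 0)"
        by (rule trans[OF sum.swap], rule sum.cong[OF refl], rule trans[OF sum.swap],
            rule sum.cong[OF refl], rule sum.swap)
      also have "\<dots> = (\<Sum>v\<in>?S. \<Sum>u\<in>?S. \<Sum>t\<in>?S. if u \<circ> t \<circ> v = w then a u * b t * c v else 0)"
        by (intro sum.cong refl) (simp add: finite_sym_group sym_comp_closed)
      also have "\<dots> = (\<Sum>u\<in>?S. \<Sum>t\<in>?S. \<Sum>v\<in>?S. if u \<circ> t \<circ> v = w then a u * b t * c v else 0)"
        by (rule trans[OF sum.swap], rule sum.cong[OF refl], rule sum.swap)
      also have "\<dots> = (\<Sum>u\<in>?S. \<Sum>t\<in>?S. \<Sum>v\<in>?S. \<Sum>x\<in>?S.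
             if t \<circ> v = x then (if u \<circ> x = w then a u * (b t * c v) else 0) else 0)"
        by (intro sum.cong refl) (simp add: finite_sym_group sym_comp_closed comp_assoc mult.assoc)
      also have "\<dots> = (\<Sum>u\<in>?S. \<Sum>x\<in>?S. \<Sum>t\<in>?S. \<Sum>v\<in>?S.
             if t \<circ> v = x then (if u \<circ> x = w then a u * (b t * c v) else 0) else 0)"
        by (rule sum.cong[OF refl], rule sym, rule trans[OF sum.swap], rule sum.cong[OF refl],
            rule sum.swap)
      also have "\<dots> = (a \<otimes>\<^bsub>?A\<^esub> (b \<otimes>\<^bsub>?A\<^esub> c)) w"
        unfolding sym_algebra_mult
        by (intro sum.cong refl) (simp add: sum_distrib_left if_distrib[of "\<lambda>z. a u * z" for u] cong: if_cong)
      finally show "(a \<otimes>\<^bsub>?A\<^esub> b \<otimes>\<^bsub>?A\<^esub> c) w = (a \<otimes>\<^bsub>?A\<^esub> (b \<otimes>\<^bsub>?A\<^esub> c)) w" .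
    qed
  qed (rule closed)
  have add: "(a \<oplus>\<^bsub>?A\<^esub> b) w = a w + b w" for a b w by (simp add: sym_algebra_def)
  fix a b c
  show "(a \<oplus>\<^bsub>?A\<^esub> b) \<otimes>\<^bsub>?A\<^esub> c = a \<otimes>\<^bsub>?A\<^esub> c \<oplus>\<^bsub>?A\<^esub> b \<otimes>\<^bsub>?A\<^esub> c"
    by (rule ext, unfold add sym_algebra_mult sum.distrib[symmetric], intro sum.cong refl)
       (simp add: algebra_simps)
  show "c \<otimes>\<^bsub>?A\<^esub> (a \<oplus>\<^bsub>?A\<^esub> b) = c \<otimes>\<^bsub>?A\<^esub> a \<oplus>\<^bsub>?A\<^esub> c \<otimes>\<^bsub>?A\<^esub> b"
    by (rule ext, unfold add sym_algebra_mult sum.distrib[symmetric], intro sum.cong refl)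
       (simp add: algebra_simps)
qed

end

theory Submission
  imports Defs
begin

text \<open>Regard a permutation as a linear order \<open>C\<close> on \<open>{1..n}\<close> and a set composition \<open>F\<close> as a total
  preorder; \<open>F\<close> acts on linear orders by breaking its own ties with \<open>C\<close> (the product of faces of the
  braid arrangement). The faces of type \<open>\<alpha>\<close> acting on \<open>u\<close> produce exactly the terms of \<open>u B\<^sub>\<alpha>\<close>, and
  right multiplication by \<open>w\<^sub>0\<close> reverses orders. So right multiplication by \<open>w\<^sub>0 B\<^sub>\<gamma>\<close> is dual to the
  operator \<open>(T f) C = (\<Sum>F. \<gamma> (type F) * f (F C\<inverse>))\<close> on functions of linear orders.

  Filter these functions by locality: \<open>f\<close> is local to an equivalence relation \<open>e\<close> if \<open>f C\<close> depends only
  on the order inside the classes of \<open>e\<close>. Let \<open>\<lambda> e\<close> be the total weight of the faces whose blocks are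
  unions of classes of \<open>e\<close>. Modulo functions local to finer relations, \<open>T\<close> acts on such \<open>f\<close> as \<open>\<lambda> e\<close> times
  reversal, and by inclusion-exclusion reversal acts as the sign \<open>(-1)\<close> to the power \<open>n\<close> minus the
  number of classes. Hence some power of the claimed polynomial annihilates \<open>T\<close>. Products of Lie
  elements show that each layer of the filtration is nonzero, so that every claimed root occurs.
  Finally, as the weights are nonnegative, the finer relations that actually appear have strictly
  larger \<open>\<lambda>\<close>; so the product of the \<open>T\<^sup>2 - \<lambda>\<^sup>2\<close> over the distinct nonzero \<open>\<lambda>\<close>, with one
  further factor \<open>T\<close> if \<open>\<lambda> = 0\<close> occurs, vanishes. Together, this makes all roots simple.\<close>

section \<open>Total preorders acting on linear orders\<close>

definition lex_order :: "'a rel \<Rightarrow> 'a rel \<Rightarrow> 'a rel" where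
  "lex_order R S = {(x, y) \<in> R. (y, x) \<in> R \<longrightarrow> (x, y) \<in> S}"

definition total_preorder_on :: "'a set \<Rightarrow> 'a rel \<Rightarrow> bool" where
  "total_preorder_on X R \<longleftrightarrow> preorder_on X R \<and> total_on X R"

lemma linear_order_onD:
  assumes "linear_order_on X C"
  shows "C \<subseteq> X \<times> X" and "x \<in> X \<Longrightarrow> (x, x) \<in> C"
    and "(x, y) \<in> C \<Longrightarrow> (y, z) \<in> C \<Longrightarrow> (x, z) \<in> C"
    and "(x, y) \<in> C \<Longrightarrow> (y, x) \<in> C \<Longrightarrow> x = y"
    and "x \<in> X \<Longrightarrow> y \<in> X \<Longrightarrow> (x, y) \<in> C \<or> (y, x) \<in> C"
proof -
  have C: "C \<subseteq> X \<times> X" "refl_on X C" "trans C" "antisym C" "total_on X C"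
    using assms by (simp_all add: order_on_defs)
  show "C \<subseteq> X \<times> X" "x \<in> X \<Longrightarrow> (x, x) \<in> C" using C(1,2) by (simp_all add: refl_on_def)
  show "(x, y) \<in> C \<Longrightarrow> (y, z) \<in> C \<Longrightarrow> (x, z) \<in> C" by (rule transD[OF C(3)])
  show "(x, y) \<in> C \<Longrightarrow> (y, x) \<in> C \<Longrightarrow> x = y" by (rule antisymD[OF C(4)])
  show "x \<in> X \<Longrightarrow> y \<in> X \<Longrightarrow> (x, y) \<in> C \<or> (y, x) \<in> C"
    using C(2,5) unfolding total_on_def by (metis refl_onD)
qed

lemma total_preorder_onD:
  assumes "total_preorder_on X R"
  shows "R \<subseteq> X \<times> X" and "x \<in> X \<Longrightarrow> (x, x) \<in> R"
    and "(x, y) \<in> R \<Longrightarrow> (y, z) \<in> R \<Longrightarrow> (x, z) \<in> R"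
    and "x \<in> X \<Longrightarrow> y \<in> X \<Longrightarrow> (x, y) \<in> R \<or> (y, x) \<in> R"
proof -
  have R: "R \<subseteq> X \<times> X" "refl_on X R" "trans R" "total_on X R"
    using assms by (simp_all add: total_preorder_on_def order_on_defs)
  show "R \<subseteq> X \<times> X" "x \<in> X \<Longrightarrow> (x, x) \<in> R" using R(1,2) by (simp_all add: refl_on_def)
  show "(x, y) \<in> R \<Longrightarrow> (y, z) \<in> R \<Longrightarrow> (x, z) \<in> R" by (rule transD[OF R(3)])
  show "x \<in> X \<Longrightarrow> y \<in> X \<Longrightarrow> (x, y) \<in> R \<or> (y, x) \<in> R"
    using R(2,4) unfolding total_on_def by (metis refl_onD)
qed

lemma linear_order_onI:
  assumes "C \<subseteq> X \<times> X" and "\<And>x. x \<in> X \<Longrightarrow> (x, x) \<in> C"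
    and "\<And>x y z. (x, y) \<in> C \<Longrightarrow> (y, z) \<in> C \<Longrightarrow> (x, z) \<in> C"
    and "\<And>x y. (x, y) \<in> C \<Longrightarrow> (y, x) \<in> C \<Longrightarrow> x = y"
    and "\<And>x y. x \<in> X \<Longrightarrow> y \<in> X \<Longrightarrow> (x, y) \<in> C \<or> (y, x) \<in> C"
  shows "linear_order_on X C"
  unfolding order_on_defs total_on_def
  by (intro conjI ballI impI refl_onI transI antisymI) (fact assms | erule assms | rule assms; assumption)+

lemma total_preorder_onI:
  assumes "C \<subseteq> X \<times> X" and "\<And>x. x \<in> X \<Longrightarrow> (x, x) \<in> C"
    and "\<And>x y z. (x, y) \<in> C \<Longrightarrow> (y, z) \<in> C \<Longrightarrow> (x, z) \<in> C"
    and "\<And>x y. x \<in> X \<Longrightarrow> y \<in> X \<Longrightarrow> (x, y) \<in> C \<or> (y, x) \<in> C"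
  shows "total_preorder_on X C"
  unfolding total_preorder_on_def order_on_defs total_on_def
  by (intro conjI ballI impI refl_onI transI) (fact assms | erule assms | rule assms; assumption)+

lemma equivD:
  assumes "equiv X e"
  shows "e \<subseteq> X \<times> X" and "x \<in> X \<Longrightarrow> (x, x) \<in> e" and "(x, y) \<in> e \<Longrightarrow> (y, x) \<in> e"
    and "(x, y) \<in> e \<Longrightarrow> (y, z) \<in> e \<Longrightarrow> (x, z) \<in> e"
proof -
  have e: "e \<subseteq> X \<times> X" "refl_on X e" "sym e" "trans e" using assms by (simp_all add: equiv_def)
  show "e \<subseteq> X \<times> X" "x \<in> X \<Longrightarrow> (x, x) \<in> e" using e(1,2) by (simp_all add: refl_on_def)
  show "(x, y) \<in> e \<Longrightarrow> (y, x) \<in> e" by (rule symD[OF e(3)])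
  show "(x, y) \<in> e \<Longrightarrow> (y, z) \<in> e \<Longrightarrow> (x, z) \<in> e" by (rule transD[OF e(4)])
qed

lemma linear_order_lex_order:
  assumes R: "total_preorder_on X R" and C: "linear_order_on X C"
  shows "linear_order_on X (lex_order R C)"
proof (rule linear_order_onI)
  show "lex_order R C \<subseteq> X \<times> X" using total_preorder_onD(1)[OF R] by (auto simp: lex_order_def)
  show "(x, x) \<in> lex_order R C" if "x \<in> X" for x
    using that total_preorder_onD(2)[OF R] linear_order_onD(2)[OF C] by (simp add: lex_order_def)
  show "(x, z) \<in> lex_order R C" if "(x, y) \<in> lex_order R C" "(y, z) \<in> lex_order R C" for x y z
    using that total_preorder_onD(3)[OF R] linear_order_onD(3)[OF C]
    by (simp add: lex_order_def) meson
  show "x = y" if "(x, y) \<in> lex_order R C" "(y, x) \<in> lex_order R C" for x y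
    using that linear_order_onD(4)[OF C] by (simp add: lex_order_def)
  show "(x, y) \<in> lex_order R C \<or> (y, x) \<in> lex_order R C" if "x \<in> X" "y \<in> X" for x y
    using that total_preorder_onD(4)[OF R, of x y] linear_order_onD(5)[OF C, of x y]
    by (auto simp: lex_order_def)
qed

lemma equiv_Int_ties:
  assumes e: "equiv X e" and R: "total_preorder_on X R"
  shows "equiv X (e \<inter> (R \<inter> R\<inverse>))"
proof (rule equivI)
  show "e \<inter> (R \<inter> R\<inverse>) \<subseteq> X \<times> X" using equivD(1)[OF e] by auto
  show "refl_on X (e \<inter> (R \<inter> R\<inverse>))"
    using equivD(2)[OF e] total_preorder_onD(2)[OF R] by (auto intro: refl_onI)
  show "sym (e \<inter> (R \<inter> R\<inverse>))" using equivD(3)[OF e] by (auto intro: symI)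
  show "trans (e \<inter> (R \<inter> R\<inverse>))"
    by (rule transI) (use equivD(4)[OF e] total_preorder_onD(3)[OF R] in \<open>simp, meson\<close>)
qed

text \<open>If a pair \<open>(x, y)\<close> of \<open>e\<close> is missing from \<open>C\<close>,
  totality puts \<open>(y, x)\<close> into \<open>C\<close>, and by symmetry of \<open>e\<close> the
  inclusion carries \<open>(y, x)\<close> over to \<open>C'\<close>. So restrictions of linear
  orders to \<open>e\<close> are never properly nested.\<close>

lemma linear_order_Int_eqI:
  assumes "linear_order_on X C" "linear_order_on X C'" "C \<inter> e \<subseteq> C' \<inter> e" "equiv X e"
  shows "C \<inter> e = C' \<inter> e"
proof -
  have "(x, y) \<in> C" if "(x, y) \<in> C'" "(x, y) \<in> e" for x y
  proof (rule ccontr)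
    assume n: "(x, y) \<notin> C"
    then have "(y, x) \<in> C" using that linear_order_onD[OF assms(1)] linear_order_onD[OF assms(2)] by blast
    then have "(y, x) \<in> C'" using assms(3) equivD(3)[OF assms(4) that(2)] by blast
    then have "x = y" using that linear_order_onD[OF assms(2)] by blast
    then show False using n \<open>(y, x) \<in> C\<close> by simp
  qed
  then show ?thesis using assms(3) by auto
qed

text \<open>Replaces an abstract linear order by an injective numbering. The numbering supports
  induction on ranks in \<open>indicator_converse_mod_lower\<close> and yields the permutation in
  \<open>linear_order_eq_perm_order\<close>.\<close>

lemma linear_order_rank:
  assumes fin: "finite X" and C: "linear_order_on X C"
  defines "r \<equiv> \<lambda>x. card {y. (y, x) \<in> C}"
  shows "C = {(x, y) \<in> X \<times> X. r x \<le> r y}" and "inj_on r X" and "r ` X \<subseteq> {1..card X}"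
proof -
  have sub: "{y. (y, x) \<in> C} \<subseteq> X" for x using linear_order_onD(1)[OF C] by auto
  have mono: "r x \<le> r y" if "(x, y) \<in> C" for x y
    unfolding r_def by (rule card_mono[OF finite_subset[OF sub fin]])
      (use linear_order_onD(3)[OF C _ that] in blast)
  have strict: "r x < r y" if "(x, y) \<in> C" "x \<noteq> y" for x y
  proof -
    have "y \<in> {z. (z, y) \<in> C}" "y \<notin> {z. (z, x) \<in> C}"
      using that linear_order_onD(1,2)[OF C] linear_order_onD(4)[OF C that(1)] by auto
    then have "{z. (z, x) \<in> C} \<subset> {z. (z, y) \<in> C}"
      using linear_order_onD(3)[OF C _ that(1)] by blast
    then show ?thesis unfolding r_def by (rule psubset_card_mono[OF finite_subset[OF sub fin]])
  qed
  show "C = {(x, y) \<in> X \<times> X. r x \<le> r y}"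
  proof (intro equalityI subsetI)
    fix p assume "p \<in> C"
    then show "p \<in> {(x, y) \<in> X \<times> X. r x \<le> r y}"
      using linear_order_onD(1)[OF C] mono by (cases p) auto
  next
    fix p assume p: "p \<in> {(x, y) \<in> X \<times> X. r x \<le> r y}"
    obtain x y where xy: "p = (x, y)" by (cases p)
    show "p \<in> C"
      using p linear_order_onD(2)[OF C, of x] linear_order_onD(5)[OF C, of x y] strict[of y x]
      by (auto simp: xy)
  qed
  show "inj_on r X"
  proof (rule inj_onI, rule ccontr)
    fix x y assume "x \<in> X" "y \<in> X" "r x = r y" "x \<noteq> y"
    then show False using linear_order_onD(5)[OF C, of x y] strict[of x y] strict[of y x] by auto
  qed
  show "r ` X \<subseteq> {1..card X}"
  proof
    fix k assume "k \<in> r ` X"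
    then obtain x where x: "x \<in> X" "k = r x" by auto
    have "card {y. (y, x) \<in> C} \<noteq> 0"
      using x linear_order_onD(2)[OF C] finite_subset[OF sub fin] by auto
    then show "k \<in> {1..card X}" using x card_mono[OF fin sub] by (auto simp: r_def)
  qed
qed

section \<open>Functions depending on a linear order only through its restriction to blocks\<close>

text \<open>Only linear orders are tested: values of \<open>f\<close> at other relations are junk,
  which \<open>local_span\<close> and \<open>annihilates\<close> ignore as well.\<close>

definition local_to :: "'a set \<Rightarrow> 'a rel \<Rightarrow> ('a rel \<Rightarrow> 'k) \<Rightarrow> bool" where
  "local_to X e f \<longleftrightarrow> (\<forall>C C'. linear_order_on X C \<longrightarrow> linear_order_on X C' \<longrightarrow>
     C \<inter> e = C' \<inter> e \<longrightarrow> f C = f C')"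

lemma local_toD:
  "local_to X e f \<Longrightarrow> linear_order_on X C \<Longrightarrow> linear_order_on X C' \<Longrightarrow> C \<inter> e = C' \<inter> e \<Longrightarrow> f C = f C'"
  unfolding local_to_def by blast

lemma local_toI:
  "(\<And>C C'. linear_order_on X C \<Longrightarrow> linear_order_on X C' \<Longrightarrow> C \<inter> e = C' \<inter> e \<Longrightarrow> f C = f C') \<Longrightarrow>
   local_to X e f"
  unfolding local_to_def by blast

lemma local_to_scale: "local_to X e f \<Longrightarrow> local_to X e (\<lambda>C. a * f C :: 'k::times)"
  unfolding local_to_def by metis

text \<open>A pair of \<open>e\<close> that \<open>R\<close> does not tie is ordered by
  \<open>R\<close> alone, so \<open>C\<close> influences \<open>lex_order R C\<close> on
  \<open>e\<close> only at pairs tied in \<open>R\<close>.\<close>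

lemma local_to_lex_order:
  assumes "total_preorder_on X R" "local_to X e f"
  shows "local_to X (e \<inter> (R \<inter> R\<inverse>)) (\<lambda>C. f (lex_order R C))"
proof (rule local_toI)
  fix C C' assume "linear_order_on X C" "linear_order_on X C'"
    and eq: "C \<inter> (e \<inter> (R \<inter> R\<inverse>)) = C' \<inter> (e \<inter> (R \<inter> R\<inverse>))"
  moreover have "lex_order R C \<inter> e = lex_order R C' \<inter> e"
  proof (intro equalityI subsetI)
    fix p assume p: "p \<in> lex_order R C \<inter> e"
    then show "p \<in> lex_order R C' \<inter> e" using eqset_imp_iff[OF eq, of p]
      by (cases p) (auto simp: lex_order_def)
  next
    fix p assume p: "p \<in> lex_order R C' \<inter> e"
    then show "p \<in> lex_order R C \<inter> e" using eqset_imp_iff[OF eq, of p]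
      by (cases p) (auto simp: lex_order_def)
  qed
  ultimately show "f (lex_order R C) = f (lex_order R C')"
    by (intro local_toD[OF assms(2)] linear_order_lex_order[OF assms(1)])
qed

lemma local_to_converse:
  assumes "sym e" "local_to X e f"
  shows "local_to X e (\<lambda>C. f (C\<inverse>))"
proof (rule local_toI)
  fix C C' assume "linear_order_on X C" "linear_order_on X C'" "C \<inter> e = C' \<inter> e"
  moreover from this have "C\<inverse> \<inter> e = C'\<inverse> \<inter> e" using assms(1) by (auto dest: symD)
  ultimately show "f (C\<inverse>) = f (C'\<inverse>)" by (intro local_toD[OF assms(2)]) simp_all
qed

text \<open>By symmetry of \<open>e\<close>, the inclusion \<open>e \<subseteq> R\<close> makes all
  pairs of \<open>e\<close> ties of \<open>R\<close>, and ties are left to \<open>C\<close>.\<close>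

lemma local_to_lex_order_cancel:
  assumes "total_preorder_on X R" "local_to X e f" "sym e" "e \<subseteq> R" "linear_order_on X C"
  shows "f (lex_order R C) = f C"
proof -
  have "lex_order R C \<inter> e = C \<inter> e" using assms(3,4) by (auto simp: lex_order_def dest: symD)
  then show ?thesis using assms by (intro local_toD[OF assms(2)] linear_order_lex_order)
qed

text \<open>The rule \<open>zero\<close> makes the span blind to values off the linear orders.
  \<open>P\<close> is a parameter because two filtrations are used: by strictly finer relations, and
  by strictly finer relations of larger weight.\<close>

inductive local_span :: "'a set \<Rightarrow> ('a rel \<Rightarrow> bool) \<Rightarrow> ('a rel \<Rightarrow> 'k::comm_ring_1) \<Rightarrow> bool"
  for X P where
  zero: "(\<And>C. linear_order_on X C \<Longrightarrow> f C = 0) \<Longrightarrow> local_span X P f"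
| base: "P e \<Longrightarrow> local_to X e f \<Longrightarrow> local_span X P f"
| add: "local_span X P f \<Longrightarrow> local_span X P g \<Longrightarrow> local_span X P (\<lambda>C. f C + g C)"

lemma local_span_cong:
  assumes "local_span X P f" "\<And>C. linear_order_on X C \<Longrightarrow> f C = g C"
  shows "local_span X P g"
proof -
  have "local_span X P (\<lambda>C. g C - f C)" using assms(2) by (intro local_span.zero) auto
  from local_span.add[OF assms(1) this] show ?thesis by simp
qed

lemma local_span_scale: "local_span X P f \<Longrightarrow> local_span X P (\<lambda>C. a * f C)"
proof (induction rule: local_span.induct)
  case (zero f)
  then show ?case by (intro local_span.zero) simp
next
  case (base e f)
  then show ?case by (intro local_span.base[of P e] local_to_scale)
next
  case (add f g)
  then show ?case using local_span.add[OF add.IH] by (simp add: distrib_left)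
qed

lemma local_span_sum:
  assumes "finite J" "\<And>j. j \<in> J \<Longrightarrow> local_span X P (f j)"
  shows "local_span X P (\<lambda>C. \<Sum>j\<in>J. f j C)"
  using assms
proof (induction J)
  case empty
  then show ?case by (intro local_span.zero) simp
next
  case (insert j J)
  then have "local_span X P (\<lambda>C. f j C + (\<Sum>j\<in>J. f j C))" by (intro local_span.add) auto
  with insert show ?case by simp
qed

lemma local_span_mono: "local_span X P f \<Longrightarrow> (\<And>e. P e \<Longrightarrow> Q e) \<Longrightarrow> local_span X Q f"
  by (induction rule: local_span.induct) (auto intro: local_span.intros)

abbreviation lower_span :: "'a set \<Rightarrow> 'a rel \<Rightarrow> ('a rel \<Rightarrow> 'k::comm_ring_1) \<Rightarrow> bool" where
  "lower_span X e \<equiv> local_span X (\<lambda>e'. equiv X e' \<and> e' \<subset> e)"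

section \<open>Reversal acts as a sign modulo functions local to finer relations\<close>

text \<open>Every class contains exactly one element minimal for \<open>r\<close>, so the elements
  outside \<open>?N\<close> form a transversal of the classes. The count becomes the exponent of the
  sign, one factor -1 per non-minimal element.\<close>

lemma card_nonminimal_elements:
  fixes r :: "'a \<Rightarrow> nat"
  assumes fin: "finite X" and e: "equiv X e" and r: "inj_on r X"
  shows "card {z \<in> X. \<exists>y. (y, z) \<in> e \<and> r y < r z} = card X - card (X // e)"
proof -
  let ?N = "{z \<in> X. \<exists>y. (y, z) \<in> e \<and> r y < r z}"
  have "bij_betw (\<lambda>x. e `` {x}) (X - ?N) (X // e)"
  proof (rule bij_betw_imageI)
    show "inj_on (\<lambda>x. e `` {x}) (X - ?N)"
    proof (rule inj_onI)
      fix x y assume x: "x \<in> X - ?N" and y: "y \<in> X - ?N" and "e `` {x} = e `` {y}"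
      then have "(x, y) \<in> e" "(y, x) \<in> e" using equivD(2,3)[OF e] by auto
      then have "\<not> r x < r y" "\<not> r y < r x" using x y by auto
      then show "x = y" using x y inj_onD[OF r, of x y] by simp
    qed
    show "(\<lambda>x. e `` {x}) ` (X - ?N) = X // e"
    proof (intro equalityI subsetI)
      fix Q assume "Q \<in> (\<lambda>x. e `` {x}) ` (X - ?N)"
      then show "Q \<in> X // e" by (auto intro: quotientI)
    next
      fix Q assume "Q \<in> X // e"
      then obtain x where x: "x \<in> X" "Q = e `` {x}" by (auto elim: quotientE)
      obtain y where y: "(x, y) \<in> e" "\<And>z. (x, z) \<in> e \<Longrightarrow> r y \<le> r z"
        using ex_has_least_nat[of "\<lambda>y. (x, y) \<in> e" x r] equivD(2)[OF e x(1)] by auto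
      have yX: "y \<in> X" using equivD(1)[OF e] y(1) by auto
      have "y \<notin> ?N"
      proof
        assume "y \<in> ?N"
        then obtain z where "(z, y) \<in> e" "r z < r y" by auto
        then show False using y(2)[of z] equivD(4)[OF e y(1) equivD(3)[OF e]] by force
      qed
      moreover have "e `` {y} = Q" using x y equiv_class_eq[OF e y(1)] by simp
      ultimately show "Q \<in> (\<lambda>x. e `` {x}) ` (X - ?N)" using yX by auto
    qed
  qed
  then have "card (X - ?N) = card (X // e)" by (rule bij_betw_same_card)
  moreover have "card (X - ?N) = card X - card ?N" using fin by (intro card_Diff_subset) auto
  moreover have "card ?N \<le> card X" using fin by (intro card_mono) auto
  ultimately show ?thesis by simp
qed

text \<open>The indicator of a restriction to \<open>e\<close> is a product of indicators
  \<open>b z\<close> comparing neighbours in a class. Reversal turns each factor into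
  \<open>1 - b z\<close>. In the expansion the full product carries the sign, and every other term
  forgets some comparison and so is local to a finer relation.\<close>

lemma indicator_converse_mod_lower:
  fixes r :: "'a \<Rightarrow> nat"
  assumes fin: "finite X" and e: "equiv X e" and r: "inj_on r X"
  defines "C0 \<equiv> {(x, y) \<in> X \<times> X. r x \<le> r y}"
  shows "lower_span X e (\<lambda>C. of_bool (C\<inverse> \<inter> e = C0 \<inter> e)
           - (-1) ^ (card X - card (X // e)) * of_bool (C \<inter> e = C0 \<inter> e) :: 'k::comm_ring_1)"
proof -
  define N where "N = {z \<in> X. \<exists>y. (y, z) \<in> e \<and> r y < r z}"
  have finN: "finite N" using fin by (simp add: N_def)
  have C0: "linear_order_on X C0"
    unfolding C0_def using inj_onD[OF r] by (intro linear_order_onI) auto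
  have "\<exists>y. (y, z) \<in> e \<and> r y < r z \<and> (\<forall>x. (x, z) \<in> e \<and> r x < r z \<longrightarrow> r x \<le> r y)"
    if zN: "z \<in> N" for z
  proof -
    obtain y where "(y, z) \<in> e \<and> r y < r z" using zN by (auto simp: N_def)
    from ex_has_greatest_nat[of "\<lambda>y. (y, z) \<in> e \<and> r y < r z" y r "r z", OF this]
    show ?thesis by auto
  qed
  \<comment> \<open>\<open>pr z\<close> is the immediate predecessor of \<open>z\<close> inside its
    class, in the order given by \<open>r\<close>.\<close>
  then obtain pr where pr: "\<And>z. z \<in> N \<Longrightarrow> (pr z, z) \<in> e" "\<And>z. z \<in> N \<Longrightarrow> r (pr z) < r z"
    "\<And>z x. z \<in> N \<Longrightarrow> (x, z) \<in> e \<Longrightarrow> r x < r z \<Longrightarrow> r x \<le> r (pr z)"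
    by metis
  have prX: "pr z \<in> X" "z \<in> X" if "z \<in> N" for z using pr(1)[OF that] equivD(1)[OF e] by auto
  \<comment> \<open>Comparisons of neighbours determine the whole restriction: transitivity along
    the chain of predecessors gives one inclusion, and \<open>linear_order_Int_eqI\<close> upgrades
    it to equality.\<close>
  have all_iff: "(\<forall>z\<in>N. (pr z, z) \<in> C) \<longleftrightarrow> C \<inter> e = C0 \<inter> e" if C: "linear_order_on X C" for C
  proof
    assume *: "\<forall>z\<in>N. (pr z, z) \<in> C"
    have "(y, z) \<in> C" if "(y, z) \<in> e" "r y \<le> r z" for y z
      using that
    proof (induction z rule: measure_induct_rule[where f = r])
      case (less z)
      have yz: "y \<in> X" "z \<in> X" using less.prems equivD(1)[OF e] by auto
      show ?case
      proof (cases "r y = r z")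
        case True
        then have "y = z" using inj_onD[OF r] yz by auto
        then show ?thesis using linear_order_onD(2)[OF C] yz by simp
      next
        case False
        then have z: "z \<in> N" and lt: "r y < r z" using less.prems yz by (auto simp: N_def)
        have "(y, pr z) \<in> e"
          using equivD(4)[OF e less.prems(1)] equivD(3)[OF e pr(1)[OF z]] by blast
        then have "(y, pr z) \<in> C" using less.IH[OF pr(2)[OF z]] pr(3)[OF z less.prems(1) lt] by blast
        then show ?thesis using linear_order_onD(3)[OF C] * z by blast
      qed
    qed
    then have "C0 \<inter> e \<subseteq> C \<inter> e" by (auto simp: C0_def)
    then show "C \<inter> e = C0 \<inter> e" using linear_order_Int_eqI[OF C0 C _ e] by simp
  next
    assume *: "C \<inter> e = C0 \<inter> e"
    show "\<forall>z\<in>N. (pr z, z) \<in> C"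
    proof
      fix z assume z: "z \<in> N"
      then have "(pr z, z) \<in> C0 \<inter> e" using pr(1,2)[OF z] prX[OF z] by (simp add: C0_def)
      then show "(pr z, z) \<in> C" using * by blast
    qed
  qed
  define b :: "'a \<Rightarrow> 'a rel \<Rightarrow> 'k" where "b z C = of_bool ((pr z, z) \<in> C)" for z C
  have prod_of_bool: "(\<Prod>z\<in>N. of_bool (Q z)) = (of_bool (\<forall>z\<in>N. Q z) :: 'k)" for Q
  proof (cases "\<forall>z\<in>N. Q z")
    case False
    then obtain z where "z \<in> N" "\<not> Q z" by auto
    then have "\<exists>z\<in>N. of_bool (Q z) = (0::'k)" by (intro bexI[of _ z]) auto
    then have "(\<Prod>z\<in>N. of_bool (Q z)) = (0::'k)" by (rule prod_zero[OF finN])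
    then show ?thesis using False by simp
  qed simp
  have prod_b: "(\<Prod>z\<in>N. b z C) = of_bool (C \<inter> e = C0 \<inter> e)" if "linear_order_on X C" for C
    unfolding b_def prod_of_bool all_iff[OF that] ..
  have prod_1b: "(\<Prod>z\<in>N. 1 - b z C) = of_bool (C\<inverse> \<inter> e = C0 \<inter> e)" if C: "linear_order_on X C" for C
  proof -
    \<comment> \<open>\<open>pr z\<close> and \<open>z\<close> are distinct, so exactly one of the
      two comparisons holds in \<open>C\<close>.\<close>
    have "1 - b z C = of_bool ((pr z, z) \<in> C\<inverse>)" if z: "z \<in> N" for z
      using linear_order_onD(4)[OF C, of z "pr z"] linear_order_onD(5)[OF C prX[OF z]] pr(2)[OF z]
      by (auto simp: b_def)
    then have "(\<Prod>z\<in>N. 1 - b z C) = (\<Prod>z\<in>N. of_bool ((pr z, z) \<in> C\<inverse>))" by (intro prod.cong) auto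
    then show ?thesis unfolding prod_of_bool using all_iff[of "C\<inverse>"] C by simp
  qed
  have proper_term: "lower_span X e (\<lambda>C. (-1) ^ card B * (\<Prod>z\<in>B. b z C))" if B: "B \<in> Pow N - {N}" for B
  proof -
    \<comment> \<open>\<open>e'\<close> cuts every class in front of each of its elements in
      \<open>N - B\<close>; the missing factors are the neighbour comparisons across these
      cuts.\<close>
    define e' where "e' = {(x, y) \<in> e. \<forall>z\<in>N - B. (x, z) \<in> e \<longrightarrow> (r z \<le> r x \<longleftrightarrow> r z \<le> r y)}"
    have "equiv X e'"
    proof (rule equivI)
      show "e' \<subseteq> X \<times> X" using equivD(1)[OF e] by (auto simp: e'_def)
      show "refl_on X e'" using equivD(2)[OF e] by (auto simp: e'_def intro: refl_onI)
      show "sym e'"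
      proof (rule symI)
        fix x y assume xy: "(x, y) \<in> e'"
        then have "(x, z) \<in> e" if "(y, z) \<in> e" for z
          using equivD(4)[OF e _ that] by (auto simp: e'_def)
        then show "(y, x) \<in> e'" using xy equivD(3)[OF e] by (auto simp: e'_def)
      qed
      show "trans e'"
      proof (rule transI)
        fix x y w assume xy: "(x, y) \<in> e'" and yw: "(y, w) \<in> e'"
        then have e2: "(x, y) \<in> e" "(y, w) \<in> e" by (auto simp: e'_def)
        have "(y, z) \<in> e" if "(x, z) \<in> e" for z
          using equivD(4)[OF e equivD(3)[OF e e2(1)] that] .
        then show "(x, w) \<in> e'" using xy yw equivD(4)[OF e e2] by (auto simp: e'_def)
      qed
    qed
    moreover have "e' \<subset> e"
    proof -
      obtain z where z: "z \<in> N" "z \<notin> B" using B by auto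
      have "(pr z, z) \<notin> e'" using pr(1,2)[OF z(1)] z by (auto simp: e'_def)
      then show ?thesis using pr(1)[OF z(1)] by (auto simp: e'_def)
    qed
    moreover have "local_to X e' (\<lambda>C. \<Prod>z\<in>B. b z C)"
    proof (intro local_toI prod.cong refl)
      fix C C' z assume C: "C \<inter> e' = C' \<inter> e'" and z: "z \<in> B"
      have zN: "z \<in> N" using z B by auto
      \<comment> \<open>A cut in front of \<open>z'\<close> separates the neighbours
        \<open>pr z\<close> and \<open>z\<close> only if \<open>z' = z\<close>, but
        \<open>z \<in> B\<close> is not a cut.\<close>
      have "r z' \<le> r (pr z) \<longleftrightarrow> r z' \<le> r z" if z': "z' \<in> N - B" "(pr z, z') \<in> e" for z'
      proof -
        have ne: "r z' \<noteq> r z" using z z' inj_onD[OF r, of z' z] zN by (auto simp: N_def)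
        have "(z', z) \<in> e" using equivD(4)[OF e equivD(3)[OF e z'(2)] pr(1)[OF zN]] .
        then show ?thesis using pr(3)[OF zN, of z'] pr(2)[OF zN] ne by force
      qed
      then have "(pr z, z) \<in> e'" using pr(1)[OF zN] by (auto simp: e'_def)
      then show "b z C = b z C'" using C by (auto simp: b_def)
    qed
    ultimately show ?thesis by (intro local_span_scale local_span.base[of _ e']) auto
  qed
  have "lower_span X e (\<lambda>C. \<Sum>B\<in>Pow N - {N}. (-1) ^ card B * (\<Prod>z\<in>B. b z C))"
    using finN proper_term by (intro local_span_sum) auto
  then show ?thesis
  proof (rule local_span_cong)
    fix C assume C: "linear_order_on X C"
    \<comment> \<open>In the expansion over subsets \<open>B\<close> of \<open>N\<close>, the term
      \<open>B = N\<close> is the signed indicator and the others are lower by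
      \<open>proper_term\<close>.\<close>
    have "(\<Prod>z\<in>N. 1 - b z C) = (\<Prod>z\<in>N. (- 1) * b z C + 1)" by (intro prod.cong) auto
    also have "\<dots> = (\<Sum>B\<in>Pow N. (-1) ^ card B * (\<Prod>z\<in>B. b z C))"
      unfolding prod_add[OF finN] by (intro sum.cong) (auto simp: prod_uminus)
    also have "\<dots> = (-1) ^ card N * (\<Prod>z\<in>N. b z C)
        + (\<Sum>B\<in>Pow N - {N}. (-1) ^ card B * (\<Prod>z\<in>B. b z C))"
      using finN by (intro sum.remove) auto
    finally show "(\<Sum>B\<in>Pow N - {N}. (-1) ^ card B * (\<Prod>z\<in>B. b z C)) = of_bool (C\<inverse> \<inter> e = C0 \<inter> e)
           - (-1) ^ (card X - card (X // e)) * of_bool (C \<inter> e = C0 \<inter> e)"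
      using prod_b[OF C] prod_1b[OF C] card_nonminimal_elements[OF fin e r]
      by (simp add: N_def[symmetric])
  qed
qed

text \<open>A local function is a finite combination of indicators of the possible restrictions to
  \<open>e\<close>, and the sign is the same for all of them.\<close>

lemma converse_mod_lower:
  fixes f :: "'a rel \<Rightarrow> 'k::comm_ring_1"
  assumes fin: "finite X" and e: "equiv X e" and f: "local_to X e f"
  shows "lower_span X e (\<lambda>C. f (C\<inverse>) - (-1) ^ (card X - card (X // e)) * f C)"
proof -
  define s :: 'k where "s = (-1) ^ (card X - card (X // e))"
  define Y where "Y = (\<lambda>C. C \<inter> e) ` {C. linear_order_on X C}"
  \<comment> \<open>\<open>SOME\<close> is harmless for \<open>Z \<in> Y\<close>: by locality all
    linear orders with restriction \<open>Z\<close> give the same value.\<close>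
  define h where "h Z = f (SOME C. linear_order_on X C \<and> C \<inter> e = Z)" for Z
  have "Y \<subseteq> Pow (X \<times> X)" using equivD(1)[OF e] by (auto simp: Y_def)
  then have finY: "finite Y" using fin finite_subset by blast
  have h: "h (C \<inter> e) = f C" if C: "linear_order_on X C" for C
  proof -
    have "linear_order_on X (SOME C'. linear_order_on X C' \<and> C' \<inter> e = C \<inter> e) \<and>
      (SOME C'. linear_order_on X C' \<and> C' \<inter> e = C \<inter> e) \<inter> e = C \<inter> e"
      by (rule someI[of _ C]) (use C in simp)
    then show ?thesis unfolding h_def using local_toD[OF f] C by blast
  qed
  have f_sum: "f C = (\<Sum>Z\<in>Y. h Z * of_bool (C \<inter> e = Z))" if C: "linear_order_on X C" for C
  proof -
    have "(\<Sum>Z\<in>Y. h Z * of_bool (C \<inter> e = Z)) = (\<Sum>Z\<in>Y. if Z = C \<inter> e then h Z else 0)"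
      by (intro sum.cong) auto
    also have "\<dots> = f C" using C finY h[OF C] by (auto simp: Y_def)
    finally show ?thesis ..
  qed
  have "lower_span X e (\<lambda>C. \<Sum>Z\<in>Y. h Z * (of_bool (C\<inverse> \<inter> e = Z) - s * of_bool (C \<inter> e = Z)))"
  proof (intro local_span_sum finY local_span_scale)
    fix Z assume "Z \<in> Y"
    then obtain C0 where C0: "linear_order_on X C0" "Z = C0 \<inter> e" by (auto simp: Y_def)
    show "lower_span X e (\<lambda>C. of_bool (C\<inverse> \<inter> e = Z) - s * of_bool (C \<inter> e = Z))"
      using indicator_converse_mod_lower[OF fin e linear_order_rank(2)[OF fin C0(1)], where 'k = 'k]
      unfolding linear_order_rank(1)[OF fin C0(1), symmetric] C0(2) s_def .
  qed
  then show ?thesis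
  proof (rule local_span_cong)
    fix C assume C: "linear_order_on X C"
    show "(\<Sum>Z\<in>Y. h Z * (of_bool (C\<inverse> \<inter> e = Z) - s * of_bool (C \<inter> e = Z))) =
      f (C\<inverse>) - (-1) ^ (card X - card (X // e)) * f C"
      using C unfolding f_sum[OF C] f_sum[of "C\<inverse>", unfolded linear_order_on_converse, OF C] s_def[symmetric]
      by (simp add: sum_subtractf sum_distrib_left algebra_simps)
  qed
qed

section \<open>Every layer of the filtration is nonzero\<close>

text \<open>For a set \<open>E\<close>, insert the elements of \<open>X\<close> in increasing order, placing \<open>x\<close> to the left of all
  earlier ones if \<open>x \<in> E\<close> and to their right otherwise; the signed sum over \<open>E\<close> of these orders is
  the Dynkin element \<open>[\<dots>[[1, 2], 3], \<dots>, n]\<close> of the free Lie algebra.\<close>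

definition dynkin_order :: "'a::linorder set \<Rightarrow> 'a set \<Rightarrow> 'a rel" where
  "dynkin_order X E = {(x, y) \<in> X \<times> X. x = y \<or> (x < y \<and> y \<notin> E) \<or> (y < x \<and> x \<in> E)}"

lemma linear_order_dynkin_order: "linear_order_on X (dynkin_order X E)"
  unfolding dynkin_order_def by (rule linear_order_onI) auto

text \<open>Ordering the classes by their least elements gives such a preorder. It serves to
  concatenate orders chosen separately in each class.\<close>

lemma exists_preorder_with_ties:
  fixes X :: "'a::linorder set"
  assumes fin: "finite X" and e: "equiv X e"
  shows "\<exists>R. total_preorder_on X R \<and> R \<inter> R\<inverse> = e"
proof -
  define m where "m x = Min (e `` {x})" for x
  have m_in: "(x, m x) \<in> e" if "x \<in> X" for x
  proof -
    have "finite (e `` {x})" using fin equivD(1)[OF e] by (auto intro: finite_subset[of _ X])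
    then have "m x \<in> e `` {x}" unfolding m_def using equivD(2)[OF e that] by (intro Min_in) auto
    then show ?thesis by simp
  qed
  have m_eq: "m x = m y" if "(x, y) \<in> e" for x y
    unfolding m_def using equiv_class_eq[OF e that] by simp
  have in_e: "(x, y) \<in> e" if "x \<in> X" "y \<in> X" "m x = m y" for x y
    using equivD(4)[OF e m_in[OF that(1)]] equivD(3)[OF e m_in[OF that(2)]] that(3) by simp
  have "{(x, y) \<in> X \<times> X. m x \<le> m y} \<inter> {(x, y) \<in> X \<times> X. m x \<le> m y}\<inverse> = e"
  proof (intro equalityI subrelI)
    fix x y assume "(x, y) \<in> {(x, y) \<in> X \<times> X. m x \<le> m y} \<inter> {(x, y) \<in> X \<times> X. m x \<le> m y}\<inverse>"
    then show "(x, y) \<in> e" by (auto intro!: in_e)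
  next
    fix x y assume "(x, y) \<in> e"
    then show "(x, y) \<in> {(x, y) \<in> X \<times> X. m x \<le> m y} \<inter> {(x, y) \<in> X \<times> X. m x \<le> m y}\<inverse>"
      using m_eq[of x y] equivD(1)[OF e] by auto
  qed
  moreover have "total_preorder_on X {(x, y) \<in> X \<times> X. m x \<le> m y}"
    by (rule total_preorder_onI) auto
  ultimately show ?thesis by blast
qed

text \<open>The functional \<open>\<Phi>\<close> evaluates at a product of Dynkin elements, one per
  class, concatenated along \<open>G\<close>. It vanishes on functions local to strictly finer
  relations, but not on the indicator of a suitable restriction to \<open>e\<close>.\<close>

lemma exists_local_not_lower:
  fixes X :: "'a::linorder set"
  assumes fin: "finite X" and e: "equiv X e"
  shows "\<exists>f. local_to X e f \<and> \<not> lower_span X e (f :: 'a rel \<Rightarrow> 'k::comm_ring_1)"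
proof -
  obtain G where G: "total_preorder_on X G" and Ge: "G \<inter> G\<inverse> = e"
    using exists_preorder_with_ties[OF fin e] by auto
  \<comment> \<open>The least element of a class has no earlier element to pass, so only elements of
    \<open>N\<close> carry a choice of side.\<close>
  define N where "N = {z \<in> X. \<exists>y. (y, z) \<in> e \<and> y < z}"
  have finN: "finite N" using fin by (simp add: N_def)
  define D where "D E = lex_order G (dynkin_order X E)" for E
  have D: "linear_order_on X (D E)" for E
    unfolding D_def by (intro linear_order_lex_order G linear_order_dynkin_order)
  have De: "D E \<inter> e = dynkin_order X E \<inter> e" for E
    unfolding D_def lex_order_def Ge[symmetric] by auto
  define \<Phi> :: "('a rel \<Rightarrow> 'k) \<Rightarrow> 'k" where "\<Phi> f = (\<Sum>E\<in>Pow N. (-1) ^ card E * f (D E))" for f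
  have zero_base: "\<Phi> g = 0" if e': "equiv X e'" "e' \<subset> e" and g: "local_to X e' g" for e' g
  proof -
    \<comment> \<open>An element of \<open>Z\<close> is separated by \<open>e'\<close> from some
      earlier element of its class. The least one, \<open>i\<close>, is the letter whose side will
      be switched.\<close>
    define Z where "Z = {z \<in> X. \<exists>y. y < z \<and> (y, z) \<in> e \<and> (y, z) \<notin> e'}"
    have "Z \<noteq> {}"
    proof -
      obtain x y where xy: "(x, y) \<in> e" "(x, y) \<notin> e'" using e'(2) by auto
      have "x \<noteq> y" using xy equivD(2)[OF e'(1)] equivD(1)[OF e] by auto
      then consider "x < y" | "y < x" by force
      then show ?thesis
      proof cases
        case 1
        then show ?thesis using xy equivD(1)[OF e] by (auto simp: Z_def)
      next
        case 2
        moreover have "(y, x) \<in> e" "(y, x) \<notin> e'" using xy equivD(3)[OF e] equivD(3)[OF e'(1)] by blast+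
        ultimately show ?thesis using equivD(1)[OF e] by (auto simp: Z_def)
      qed
    qed
    define i where "i = Min Z"
    have finZ: "finite Z" using fin by (simp add: Z_def)
    have i: "i \<in> Z" "\<And>z. z \<in> Z \<Longrightarrow> i \<le> z" unfolding i_def using finZ \<open>Z \<noteq> {}\<close> by auto
    have iN: "i \<in> N" using i(1) by (auto simp: Z_def N_def)
    \<comment> \<open>If \<open>i\<close> were \<open>e'\<close>-related to an earlier
      \<open>j\<close>, then \<open>j\<close> would be separated from \<open>k\<close>, and the
      larger of these two would be an element of \<open>Z\<close> below \<open>i\<close>.\<close>
    have not_e': "(j, i) \<notin> e'" if "j < i" "(j, i) \<in> e" for j
    proof
      assume ji: "(j, i) \<in> e'"
      obtain k where k: "k < i" "(k, i) \<in> e" "(k, i) \<notin> e'" using i(1) by (auto simp: Z_def)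
      have kj: "(k, j) \<notin> e'" using k(3) ji equivD(4)[OF e'(1)] by blast
      then have jk: "(j, k) \<notin> e'" using equivD(3)[OF e'(1)] by blast
      have kje: "(k, j) \<in> e" "(j, k) \<in> e" using equivD(3,4)[OF e] k(2) that(2) by blast+
      have "j \<noteq> k" using k(3) ji by auto
      then have "j < k \<or> k < j" by auto
      then have "j \<in> Z \<or> k \<in> Z" using kj jk kje equivD(1)[OF e] unfolding Z_def by blast
      then show False using i(2) that(1) k(1) by (meson leD)
    qed
    \<comment> \<open>Switching the side of \<open>i\<close> changes only comparisons with earlier
      elements, none of which \<open>e'\<close> sees. Hence the terms for \<open>E\<close> and
      \<open>insert i E\<close> cancel.\<close>
    have toggle: "g (D (insert i E)) = g (D E)" for E
    proof (rule local_toD[OF g D D])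
      have "D (insert i E) \<inter> e' = dynkin_order X (insert i E) \<inter> e'"
        using De[of "insert i E"] e'(2) by auto
      also have "\<dots> = dynkin_order X E \<inter> e'"
        using not_e' e'(2) equivD(3)[OF e'(1)] by (auto simp: dynkin_order_def)
      also have "\<dots> = D E \<inter> e'" using De[of E] e'(2) by auto
      finally show "D (insert i E) \<inter> e' = D E \<inter> e'" .
    qed
    define M where "M = N - {i}"
    have N: "N = insert i M" "i \<notin> M" "finite M" using iN finN by (auto simp: M_def)
    have "\<Phi> g = (\<Sum>E\<in>Pow M. (-1) ^ card E * g (D E)) + (\<Sum>E\<in>insert i ` Pow M. (-1) ^ card E * g (D E))"
      unfolding \<Phi>_def N(1) Pow_insert using N by (intro sum.union_disjoint) auto
    also have "(\<Sum>E\<in>insert i ` Pow M. (-1) ^ card E * g (D E)) =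
        (\<Sum>E\<in>Pow M. (-1) ^ card (insert i E) * g (D (insert i E)))"
      using N(2) by (subst sum.reindex) (auto intro!: inj_onI simp: insert_ident)
    also have "\<dots> = (\<Sum>E\<in>Pow M. - ((-1) ^ card E * g (D E)))"
    proof (intro sum.cong refl)
      fix E assume "E \<in> Pow M"
      then have "card (insert i E) = Suc (card E)" using N finite_subset[of E M] by (auto simp: card_insert_if)
      then show "(-1) ^ card (insert i E) * g (D (insert i E)) = - ((-1) ^ card E * g (D E))"
        by (simp add: toggle)
    qed
    finally show ?thesis by (simp add: sum_negf)
  qed
  have zero: "\<Phi> g = 0" if "lower_span X e g" for g
    using that
  proof (induction rule: local_span.induct)
    case (zero f)
    then show ?case using D by (simp add: \<Phi>_def)
  next
    case (base e' f)
    then show ?case using zero_base by blast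
  next
    case (add f g)
    then show ?case by (simp add: \<Phi>_def distrib_left sum.distrib)
  qed
  \<comment> \<open>Among the subsets of \<open>N\<close>, only \<open>{}\<close> makes every class
    increasing, so this indicator picks out a single term of \<open>\<Phi>\<close>, with sign
    1.\<close>
  define f :: "'a rel \<Rightarrow> 'k" where "f C = of_bool (C \<inter> e = D {} \<inter> e)" for C
  have "f (D E) = 0" if E: "E \<in> Pow N - {{}}" for E
  proof -
    obtain z where z: "z \<in> E" "z \<in> N" using E by auto
    then obtain y where "(y, z) \<in> e" "y < z" by (auto simp: N_def)
    then have "(y, z) \<in> D {} \<inter> e" "(y, z) \<notin> D E \<inter> e"
      using z equivD(1)[OF e] unfolding De by (auto simp: dynkin_order_def)
    then show ?thesis by (auto simp: f_def)
  qed
  then have "(\<Sum>E\<in>Pow N - {{}}. (-1) ^ card E * f (D E)) = 0" by (intro sum.neutral) auto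
  moreover have "\<Phi> f = (-1) ^ card ({} :: 'a set) * f (D {}) + (\<Sum>E\<in>Pow N - {{}}. (-1) ^ card E * f (D E))"
    unfolding \<Phi>_def using finN by (intro sum.remove) auto
  ultimately have "\<Phi> f = 1" by (simp add: f_def)
  then have "\<not> lower_span X e f" using zero by force
  moreover have "local_to X e f" by (intro local_toI) (simp add: f_def)
  ultimately show ?thesis by blast
qed

section \<open>Polynomials in a linear operator on functions\<close>

definition poly_op :: "(('b \<Rightarrow> 'k) \<Rightarrow> 'b \<Rightarrow> 'k) \<Rightarrow> 'k::comm_ring_1 poly \<Rightarrow> ('b \<Rightarrow> 'k) \<Rightarrow> 'b \<Rightarrow> 'k" where
  "poly_op T p f x = (\<Sum>i\<le>degree p. coeff p i * (T ^^ i) f x)"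

lemma poly_op_altdef:
  assumes "degree p \<le> m"
  shows "poly_op T p f x = (\<Sum>i\<le>m. coeff p i * (T ^^ i) f x)"
  unfolding poly_op_def using assms by (intro sum.mono_neutral_left) (auto simp: coeff_eq_0)

lemma poly_op_add: "poly_op T (p + q) f x = poly_op T p f x + poly_op T q f x"
proof -
  let ?m = "max (degree p) (degree q)"
  have "degree (p + q) \<le> ?m" by (rule degree_add_le_max)
  then show ?thesis
    by (simp add: poly_op_altdef[of _ ?m] distrib_right sum.distrib)
qed

lemma poly_op_smult: "poly_op T (Polynomial.smult a p) f x = a * poly_op T p f x"
  by (subst poly_op_altdef[of _ "degree p"])
     (auto simp: degree_smult_le poly_op_def sum_distrib_left mult.assoc)

lemma poly_op_0 [simp]: "poly_op T 0 f x = 0"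
  by (simp add: poly_op_def)

text \<open>A Horner rule that applies \<open>T\<close> to the argument first. This is why
  \<open>poly_op_linear\<close>, \<open>poly_op_mult\<close> and \<open>poly_op_cong\<close> are
  proved by induction with the functions generalized.\<close>

lemma poly_op_pCons: "poly_op T (pCons a p) f x = a * f x + poly_op T p (T f) x"
proof -
  have "poly_op T (pCons a p) f x = (\<Sum>i\<le>Suc (degree p). coeff (pCons a p) i * (T ^^ i) f x)"
    by (rule poly_op_altdef) (rule degree_pCons_le)
  also have "\<dots> = a * f x + (\<Sum>i\<le>degree p. coeff p i * (T ^^ Suc i) f x)"
    by (subst sum.atMost_Suc_shift) simp
  finally show ?thesis by (simp add: poly_op_def funpow_swap1)
qed

locale linear_operator =
  fixes T :: "('b \<Rightarrow> 'k) \<Rightarrow> 'b \<Rightarrow> 'k::comm_ring_1"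
  assumes linear: "T (\<lambda>x. a * f x + g x) = (\<lambda>x. a * T f x + T g x)"
begin

lemma poly_op_linear:
  "poly_op T p (\<lambda>x. a * f x + g x) = (\<lambda>x. a * poly_op T p f x + poly_op T p g x)"
proof (induction p arbitrary: f g)
  case (pCons b p)
  show ?case by (rule ext) (simp add: poly_op_pCons linear pCons.IH distrib_left mult.left_commute)
qed (simp add: fun_eq_iff)

lemma poly_op_mult: "poly_op T (p * q) f = poly_op T q (poly_op T p f)"
proof (induction p arbitrary: f)
  case 0
  \<comment> \<open>With \<open>a = -1\<close> and zero functions, linearity reads v = -v + v for
    the value v at zero.\<close>
  have "poly_op T q (\<lambda>x. 0) = (\<lambda>x. 0)"
    using poly_op_linear[of q "-1" "\<lambda>x. 0" "\<lambda>x. 0"] by (simp add: fun_eq_iff)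
  moreover have "poly_op T 0 f = (\<lambda>x. 0)" by (simp add: fun_eq_iff)
  ultimately show ?case by simp
next
  case (pCons a p)
  have "poly_op T (pCons a p) f = (\<lambda>x. a * f x + poly_op T p (T f) x)"
    by (simp add: poly_op_pCons fun_eq_iff)
  then show ?case
    by (simp add: poly_op_add poly_op_smult poly_op_pCons poly_op_linear pCons.IH fun_eq_iff)
qed

lemma poly_op_linear_factor: "poly_op T [:-k, 1:] f = (\<lambda>x. T f x - k * f x)"
  by (simp add: fun_eq_iff poly_op_pCons)

text \<open>\<open>T\<close> is itself the value of the polynomial \<open>[:0, 1:]\<close>, and
  multiplication of polynomials commutes.\<close>

lemma poly_op_step: "poly_op T p (T f) = T (poly_op T p f)"
proof -
  have T: "poly_op T [:0, 1:] g = T g" for g by (simp add: fun_eq_iff poly_op_pCons)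
  show ?thesis using poly_op_mult[of "[:0, 1:]" p f] poly_op_mult[of p "[:0, 1:]" f]
    unfolding T by (simp only: mult.commute)
qed

end

section \<open>The weighted operator\<close>

text \<open>Abstract setting for the spectral argument, instantiated later with the set compositions
  of \<open>{1..n}\<close>, weighted through their types.\<close>

locale weighted_preorders =
  fixes X :: "'a::linorder set" and I :: "'i set" and R :: "'i \<Rightarrow> 'a rel"
    and c :: "'i \<Rightarrow> 'k::linordered_field"
  assumes finite_X: "finite X" and finite_I: "finite I"
    and R: "i \<in> I \<Longrightarrow> total_preorder_on X (R i)"
    and c_nonneg: "i \<in> I \<Longrightarrow> 0 \<le> c i"
begin

definition T :: "('a rel \<Rightarrow> 'k) \<Rightarrow> 'a rel \<Rightarrow> 'k" where
  "T f C = (\<Sum>i\<in>I. c i * f (lex_order (R i) (C\<inverse>)))"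

text \<open>For symmetric \<open>e\<close>, the condition \<open>e \<subseteq> R i\<close> says that
  every class of \<open>e\<close> lies within one block of ties of \<open>R i\<close>.\<close>

definition weight :: "'a rel \<Rightarrow> 'k" where
  "weight e = (\<Sum>i\<in>{i \<in> I. e \<subseteq> R i}. c i)"

definition signed_weight :: "'a rel \<Rightarrow> 'k" where
  "signed_weight e = (-1) ^ (card X - card (X // e)) * weight e"

sublocale linear_operator T
  by unfold_locales
     (simp add: T_def fun_eq_iff distrib_left sum.distrib sum_distrib_left mult.left_commute)

lemma T_cong:
  assumes "\<And>C. linear_order_on X C \<Longrightarrow> f C = g C" "linear_order_on X C"
  shows "T f C = T g C"
  unfolding T_def using assms(2) R
  by (intro sum.cong refl arg_cong2[where f = "(*)"] assms(1) linear_order_lex_order) auto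

lemma poly_op_cong:
  assumes "\<And>C. linear_order_on X C \<Longrightarrow> f C = g C" "linear_order_on X C"
  shows "poly_op T p f C = poly_op T p g C"
  using assms(1)
proof (induction p arbitrary: f g)
  case (pCons a p)
  have "poly_op T p (T f) C = poly_op T p (T g) C"
    by (rule pCons.IH) (rule T_cong[OF pCons.prems])
  then show ?case using pCons.prems[OF assms(2)] by (simp add: poly_op_pCons)
qed simp

lemma weight_nonneg: "0 \<le> weight e"
  unfolding weight_def using c_nonneg by (intro sum_nonneg) auto

lemma weight_antimono: "e' \<subseteq> e \<Longrightarrow> weight e \<le> weight e'"
  unfolding weight_def using c_nonneg finite_I by (intro sum_mono2) auto

text \<open>Every \<open>R j\<close> containing \<open>e\<close> also contains the smaller relation,
  and \<open>R i\<close> joins them with positive weight. Here nonnegativity of the weights forces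
  strict growth.\<close>

lemma weight_strict_antimono:
  assumes "i \<in> I" "c i \<noteq> 0" "\<not> e \<subseteq> R i"
  shows "weight e < weight (e \<inter> (R i \<inter> (R i)\<inverse>))"
proof -
  let ?e = "e \<inter> (R i \<inter> (R i)\<inverse>)"
  have "weight e < c i + weight e" using assms c_nonneg[of i] by simp
  also have "\<dots> = (\<Sum>j\<in>insert i {j \<in> I. e \<subseteq> R j}. c j)"
    unfolding weight_def using finite_I assms by (subst sum.insert) auto
  also have "\<dots> \<le> weight ?e"
    unfolding weight_def using assms c_nonneg finite_I by (intro sum_mono2) auto
  finally show ?thesis .
qed

text \<open>Preorders containing \<open>e\<close> leave the reversal of \<open>f\<close> unchanged
  and together contribute the main term. Any other preorder of nonzero weight yields a function
  local to a strictly finer and strictly heavier relation.\<close>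

lemma T_mod_heavier:
  assumes e: "equiv X e" and f: "local_to X e f"
  shows "local_span X (\<lambda>e'. equiv X e' \<and> e' \<subset> e \<and> weight e < weight e')
           (\<lambda>C. T f C - weight e * f (C\<inverse>))"
proof -
  let ?g = "\<lambda>i C. if e \<subseteq> R i then 0 else c i * f (lex_order (R i) (C\<inverse>))"
  have sym_e: "sym e" using e by (simp add: equiv_def)
  have "local_span X (\<lambda>e'. equiv X e' \<and> e' \<subset> e \<and> weight e < weight e') (\<lambda>C. \<Sum>i\<in>I. ?g i C)"
  proof (intro local_span_sum finite_I)
    fix i assume i: "i \<in> I"
    let ?e = "e \<inter> (R i \<inter> (R i)\<inverse>)"
    show "local_span X (\<lambda>e'. equiv X e' \<and> e' \<subset> e \<and> weight e < weight e') (?g i)"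
    \<comment> \<open>A preorder of weight zero need not make the relation heavier, so its vanishing
      term is sorted out here.\<close>
    proof (cases "e \<subseteq> R i \<or> c i = 0")
      case True
      then show ?thesis by (intro local_span.zero) auto
    next
      case False
      have eq: "equiv X ?e" by (rule equiv_Int_ties[OF e R[OF i]])
      have "local_to X ?e (\<lambda>C. f (lex_order (R i) (C\<inverse>)))"
        using local_to_converse[OF _ local_to_lex_order[OF R[OF i] f]] eq by (simp add: equiv_def)
      moreover have "weight e < weight ?e" "?e \<subset> e"
        using weight_strict_antimono[OF i] False by auto
      ultimately have "local_span X (\<lambda>e'. equiv X e' \<and> e' \<subset> e \<and> weight e < weight e')
          (\<lambda>C. c i * f (lex_order (R i) (C\<inverse>)))"
        using eq by (intro local_span_scale local_span.base[of _ ?e]) auto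
      then show ?thesis using False by simp
    qed
  qed
  then show ?thesis
  proof (rule local_span_cong)
    fix C assume C: "linear_order_on X C"
    have "T f C = (\<Sum>i\<in>I. (if e \<subseteq> R i then c i * f (C\<inverse>) else 0) + ?g i C)"
      unfolding T_def using local_to_lex_order_cancel[OF R f sym_e] C by (intro sum.cong refl) auto
    also have "\<dots> = weight e * f (C\<inverse>) + (\<Sum>i\<in>I. ?g i C)"
      unfolding sum.distrib weight_def using finite_I
      by (simp add: sum_distrib_right sum.inter_filter if_distrib[of "\<lambda>z. z * f (C\<inverse>)"] cong: if_cong)
    finally show "(\<Sum>i\<in>I. ?g i C) = T f C - weight e * f (C\<inverse>)" by simp
  qed
qed

text \<open>\<open>T\<close> sends a function local to \<open>e\<close> to a sum of functions local
  to \<open>e\<close> or finer relations, so any refinement-closed \<open>P\<close> gives an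
  invariant span.\<close>

lemma local_span_T:
  assumes "local_span X P f" and "\<And>e e'. P e \<Longrightarrow> equiv X e' \<Longrightarrow> e' \<subseteq> e \<Longrightarrow> P e'"
    and "\<And>e. P e \<Longrightarrow> equiv X e"
  shows "local_span X P (T f)"
  using assms(1)
proof (induction rule: local_span.induct)
  case (zero f)
  then have "T f C = 0" if "linear_order_on X C" for C
    using T_cong[of f "\<lambda>_. 0", OF _ that] by (simp add: T_def)
  then show ?case by (intro local_span.zero)
next
  case (base e f)
  have e: "equiv X e" using assms(3) base by blast
  have "local_span X P (\<lambda>C. T f C - weight e * f (C\<inverse>))"
    using T_mod_heavier[OF e base(2)] by (rule local_span_mono) (auto intro: assms(2)[OF base(1)])
  moreover have "local_span X P (\<lambda>C. weight e * f (C\<inverse>))"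
    using base e by (intro local_span_scale local_span.base[of _ e] local_to_converse) (auto simp: equiv_def)
  ultimately show ?case using local_span.add by fastforce
next
  case (add f g)
  then show ?case using linear[of 1 f g] local_span.add[OF add.IH] by simp
qed

text \<open>The reversal left over in \<open>T_mod_heavier\<close> is a sign modulo lower functions,
  so \<open>T\<close> acts on the layer of \<open>e\<close> as a scalar.\<close>

lemma T_mod_lower:
  assumes e: "equiv X e" and f: "local_to X e f"
  shows "lower_span X e (\<lambda>C. T f C - signed_weight e * f C)"
proof -
  have "lower_span X e (\<lambda>C. T f C - weight e * f (C\<inverse>))"
    using T_mod_heavier[OF e f] by (rule local_span_mono) auto
  from local_span.add[OF this local_span_scale[OF converse_mod_lower[OF finite_X e f], of "weight e"]]
  show ?thesis by (simp add: signed_weight_def algebra_simps)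
qed

text \<open>Since \<open>T\<close> preserves the lower functions, its scalar action on the layer
  passes to polynomials in \<open>T\<close>.\<close>

lemma poly_op_mod_lower:
  assumes e: "equiv X e" and f: "local_to X e f"
  shows "lower_span X e (\<lambda>C. poly_op T p f C - poly p (signed_weight e) * f C)"
proof (induction p)
  case 0
  show ?case by (intro local_span.zero) simp
next
  case (pCons a p)
  define k where "k = signed_weight e"
  let ?g = "\<lambda>C. poly_op T p f C - poly p k * f C"
  have "lower_span X e (T ?g)"
    by (rule local_span_T[OF pCons.IH[folded k_def]]) auto
  from local_span.add[OF this local_span_scale[OF T_mod_lower[OF e f], of "poly p k"]]
  have *: "lower_span X e (\<lambda>C. T ?g C + poly p k * (T f C - k * f C))" by (simp add: k_def)
  have "T (poly_op T p f) = (\<lambda>C. poly p k * T f C + T ?g C)"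
    using linear[of "poly p k" f ?g] by simp
  then have "T ?g C + poly p k * (T f C - k * f C) =
      poly_op T (pCons a p) f C - poly (pCons a p) k * f C" for C
    by (simp add: poly_op_pCons poly_op_step algebra_simps)
  with * show ?case by (simp add: k_def)
qed

section \<open>Annihilating polynomials of the operator\<close>

definition annihilates :: "'k poly \<Rightarrow> ('a rel \<Rightarrow> 'k) \<Rightarrow> bool" where
  "annihilates p f \<longleftrightarrow> (\<forall>C. linear_order_on X C \<longrightarrow> poly_op T p f C = 0)"

text \<open>On a layer \<open>p\<close> acts as the scalar \<open>poly p (signed_weight e)\<close>.
  If this scalar were invertible, every function local to \<open>e\<close> would be lower, contrary
  to \<open>exists_local_not_lower\<close>.\<close>

lemma annihilating_poly_root:
  assumes "\<And>f. annihilates p f" and e: "equiv X e"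
  shows "poly p (signed_weight e) = 0"
proof (rule ccontr)
  assume nz: "poly p (signed_weight e) \<noteq> 0"
  obtain f where f: "local_to X e f" "\<not> lower_span X e (f :: _ \<Rightarrow> 'k)"
    using exists_local_not_lower[OF finite_X e] by blast
  from local_span_scale[OF poly_op_mod_lower[OF e f(1), of p], of "- inverse (poly p (signed_weight e))"]
  have "lower_span X e f"
    by (rule local_span_cong) (use assms(1)[of f] nz in \<open>auto simp: annihilates_def\<close>)
  then show False using f(2) by contradiction
qed

lemma annihilates_mult_right: "annihilates p f \<Longrightarrow> annihilates (p * q) f"
  unfolding annihilates_def poly_op_mult
proof (intro allI impI)
  fix C assume *: "\<forall>C. linear_order_on X C \<longrightarrow> poly_op T p f C = 0" and C: "linear_order_on X C"
  have "poly_op T q (poly_op T p f) C = poly_op T q (\<lambda>_. 0) C"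
    by (rule poly_op_cong) (use * C in auto)
  also have "\<dots> = 0"
    using poly_op_linear[of q "-1" "\<lambda>x. 0" "\<lambda>x. 0"] by (simp add: fun_eq_iff)
  finally show "poly_op T q (poly_op T p f) C = 0" .
qed

lemma annihilates_mult_iff: "annihilates (p * q) f \<longleftrightarrow> annihilates q (poly_op T p f)"
  by (simp add: annihilates_def poly_op_mult)

lemma annihilates_local_span:
  assumes "local_span X P f" "\<And>e f. P e \<Longrightarrow> local_to X e f \<Longrightarrow> annihilates p f"
  shows "annihilates p f"
  using assms(1)
proof (induction rule: local_span.induct)
  case (zero f)
  have "poly_op T p f C = poly_op T p (\<lambda>_. 0) C" if "linear_order_on X C" for C
    by (rule poly_op_cong[OF _ that]) (use zero in auto)
  moreover have "poly_op T p (\<lambda>_. 0) C = 0" for C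
    using poly_op_linear[of p "-1" "\<lambda>x. 0" "\<lambda>x. 0"] by (simp add: fun_eq_iff)
  ultimately show ?case by (simp add: annihilates_def)
next
  case (base e f)
  then show ?case using assms(2) by blast
next
  case (add f g)
  then show ?case using poly_op_linear[of p 1 f g] by (simp add: annihilates_def)
qed

text \<open>Each linear factor of \<open>p\<close> belonging to the current relation moves
  \<open>f\<close> to strictly finer relations, and \<open>card e\<close> bounds how often this can
  happen.\<close>

lemma power_annihilates:
  assumes p: "\<And>e. equiv X e \<Longrightarrow> poly p (signed_weight e) = 0"
    and "equiv X e" "local_to X e f" "card e < m"
  shows "annihilates (p ^ m) f"
  using assms(2-)
proof (induction m arbitrary: e f)
  case (Suc m)
  define k where "k = signed_weight e"
  have fin: "finite e" using finite_X equivD(1)[OF Suc.prems(1)] finite_subset by blast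
  have "[:-k, 1:] dvd p" using p[OF Suc.prems(1)] by (simp add: poly_eq_0_iff_dvd k_def)
  then obtain q where q: "p = [:-k, 1:] * q" by (elim dvdE)
  \<comment> \<open>One copy of \<open>p\<close> supplies the factor that moves \<open>f\<close>
    down; its cofactor \<open>q\<close> does no harm.\<close>
  have "annihilates (p ^ m) (poly_op T [:-k, 1:] f)"
    unfolding poly_op_linear_factor k_def
  proof (rule annihilates_local_span[OF T_mod_lower[OF Suc.prems(1,2)]])
    fix e' and g :: "_ \<Rightarrow> 'k" assume e': "equiv X e' \<and> e' \<subset> e" and g: "local_to X e' g"
    have "card e' < card e" using e' fin by (intro psubset_card_mono) auto
    then show "annihilates (p ^ m) g" using Suc.IH[of e' g] Suc.prems(3) e' g by auto
  qed
  then have "annihilates ([:-k, 1:] * (p ^ m * q)) f"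
    unfolding annihilates_mult_iff[of "[:-k, 1:]"] by (rule annihilates_mult_right)
  moreover have "[:-k, 1:] * (p ^ m * q) = p ^ Suc m"
    using arg_cong[OF q, of "\<lambda>r. r * p ^ m"] by (simp only: power_Suc mult_ac)
  ultimately show ?case by simp
qed simp

text \<open>The operator sends \<open>f\<close> to \<open>weight e\<close> times its reversal up to functions local to relations
  of larger weight, and reversing twice does nothing. Hence \<open>T\<^sup>2 - (weight e)\<^sup>2\<close>, and already \<open>T\<close> if
  the weight vanishes, raises the weight strictly, so that no factor is needed twice.\<close>

lemma squarefree_annihilates:
  assumes "equiv X e" "local_to X e f" "finite A"
    and "\<And>e'. equiv X e' \<Longrightarrow> e' \<subseteq> e \<Longrightarrow> weight e' \<in> A \<and> - weight e' \<in> A"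
  shows "annihilates (\<Prod>k\<in>A. [:-k, 1:]) f"
  using assms
proof (induction "card e" arbitrary: e f A rule: less_induct)
  case less
  note e = less.prems(1) and f = less.prems(2)
  define l where "l = weight e"
  let ?P = "\<lambda>e'. equiv X e' \<and> e' \<subset> e \<and> l < weight e'"
  define q where "q = (\<Prod>k\<in>A - {l, -l}. [:-k, 1:])"
  have fin: "finite e" using finite_X equivD(1)[OF e] finite_subset by blast
  have q: "annihilates q g" if g: "local_span X ?P g" for g
  proof (rule annihilates_local_span[OF g])
    fix e' and g :: "_ \<Rightarrow> 'k" assume e': "?P e'" and g: "local_to X e' g"
    show "annihilates q g"
      unfolding q_def
    proof (rule less.hyps[of e'])
      show "card e' < card e" using e' fin by (intro psubset_card_mono) auto
      fix e'' assume e'': "equiv X e''" "e'' \<subseteq> e'"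
      \<comment> \<open>As \<open>0 \<le> l < weight e''\<close>, neither \<open>weight e''\<close>
        nor its negative equals \<open>l\<close> or \<open>-l\<close>, so both survive in the
        smaller set.\<close>
      then have "l < weight e''" using weight_antimono[OF e''(2)] e' by auto
      then show "weight e'' \<in> A - {l, - l} \<and> - weight e'' \<in> A - {l, - l}"
        using less.prems(4)[OF e''(1)] e' e''(2) weight_nonneg[of e] by (auto simp: l_def)
    qed (use e' g less.prems(3) in auto)
  qed
  have l: "l \<in> A" "-l \<in> A" using less.prems(4)[OF e] by (auto simp: l_def)
  have Tf: "local_span X ?P (\<lambda>C. T f C - l * f (C\<inverse>))"
    using T_mod_heavier[OF e f] by (simp add: l_def)
  show ?case
  proof (cases "l = 0")
    case True
    \<comment> \<open>For \<open>l = 0\<close> the two roots coincide, and one factor suffices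
      because \<open>T f\<close> itself already lies in the heavier span.\<close>
    then have "(\<Prod>k\<in>A. [:-k, 1:]) = [:-0, 1:] * q"
      using l less.prems(3) by (simp add: q_def prod.remove[of A 0])
    moreover have "annihilates ([:-0, 1:] * q) f"
      unfolding annihilates_mult_iff poly_op_linear_factor using q Tf True by simp
    ultimately show ?thesis by simp
  next
    case False
    have "A - {l, -l} = A - {l} - {-l}" by auto
    then have "(\<Prod>k\<in>A. [:-k, 1:]) = [:-l, 1:] * ([:-(-l), 1:] * q)"
      using l less.prems(3) False by (simp add: q_def prod.remove[of A l] prod.remove[of "A - {l}" "-l"])
    \<comment> \<open>Writing g for the reversal of \<open>f\<close>, which is again local to
      \<open>e\<close>, the function equals T(T f - l g) + l(T g - l f). Both brackets lie in the
      heavier span, and \<open>T\<close> preserves it.\<close>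
    moreover have "local_span X ?P (poly_op T [:-(-l), 1:] (poly_op T [:-l, 1:] f))"
    proof -
      have fc: "local_to X e (\<lambda>C. f (C\<inverse>))"
        using e f by (intro local_to_converse) (auto simp: equiv_def)
      have Tfc: "local_span X ?P (\<lambda>C. T (\<lambda>C. f (C\<inverse>)) C - l * f C)"
        using T_mod_heavier[OF e fc] by (simp add: l_def)
      have TTf: "local_span X ?P (T (\<lambda>C. T f C - l * f (C\<inverse>)))"
        by (rule local_span_T[OF Tf]) (use weight_antimono in \<open>auto intro: less_le_trans\<close>)
      have T1: "T (\<lambda>C. T f C - l * f (C\<inverse>)) = (\<lambda>C. - l * T (\<lambda>C. f (C\<inverse>)) C + T (T f) C)"
        using linear[of "- l" "\<lambda>C. f (C\<inverse>)" "T f"] by simp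
      have T2: "T (\<lambda>C. T f C - l * f C) = (\<lambda>C. - l * T f C + T (T f) C)"
        using linear[of "- l" f "T f"] by simp
      have "poly_op T [:-(-l), 1:] (poly_op T [:-l, 1:] f) =
          (\<lambda>C. T (\<lambda>C. T f C - l * f (C\<inverse>)) C + l * (T (\<lambda>C. f (C\<inverse>)) C - l * f C))"
        unfolding poly_op_linear_factor T1 T2 by (simp add: fun_eq_iff algebra_simps)
      then show ?thesis using local_span.add[OF TTf local_span_scale[OF Tfc, of l]] by simp
    qed
    ultimately show ?thesis using q by (simp only: annihilates_mult_iff)
  qed
qed

text \<open>Division of \<open>q\<close> by \<open>[:-k, 1:]\<close> leaves the constant remainder
  \<open>poly q k\<close>. Multiplying by \<open>p\<close> expresses \<open>poly q k\<close> times
  \<open>p\<close> through two annihilating polynomials.\<close>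

lemma annihilates_cancel_factor:
  assumes pk: "annihilates (p * [:-k, 1:]) f" and q: "annihilates q f" and k: "poly q k \<noteq> 0"
  shows "annihilates p f"
proof -
  have "q = [:-k, 1:] * synthetic_div q k + [:poly q k:]" by (rule synthetic_div_correct'[symmetric])
  from arg_cong[OF this, of "\<lambda>r. r * p"]
  have eq: "q * p = p * [:-k, 1:] * synthetic_div q k + Polynomial.smult (poly q k) p"
    by (simp add: algebra_simps del: synthetic_div_correct')
  have "annihilates (q * p) f" "annihilates (p * [:-k, 1:] * synthetic_div q k) f"
    using annihilates_mult_right[OF q] annihilates_mult_right[OF pk] by blast+
  then have "\<forall>C. linear_order_on X C \<longrightarrow> poly q k * poly_op T p f C = 0"
    unfolding eq annihilates_def poly_op_add poly_op_smult by simp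
  then show ?thesis using k by (simp add: annihilates_def)
qed

lemma finite_equivs: "finite {e. equiv X e}"
proof (rule finite_subset)
  show "{e. equiv X e} \<subseteq> Pow (X \<times> X)" using equivD(1) by blast
qed (use finite_X in simp)

lemma signed_weight_poly_annihilates:
  "annihilates (\<Prod>k\<in>signed_weight ` {e. equiv X e}. [:-k, 1:]) f"
proof -
  define K where "K = signed_weight ` {e. equiv X e}"
  define p where "p = (\<Prod>k\<in>K. [:-k, 1:])"
  define A where "A = weight ` {e. equiv X e} \<union> (\<lambda>e. - weight e) ` {e. equiv X e}"
  have finK: "finite K" and finA: "finite A" using finite_equivs by (auto simp: K_def A_def)
  have KA: "K \<subseteq> A"
  proof
    fix k assume "k \<in> K"
    then obtain e where e: "equiv X e" "k = signed_weight e" by (auto simp: K_def)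
    have "(-1) ^ (card X - card (X // e)) = (1 :: 'k) \<or> (-1) ^ (card X - card (X // e)) = (-1 :: 'k)"
      by (cases "even (card X - card (X // e))") auto
    then show "k \<in> A" using e by (auto simp: signed_weight_def A_def)
  qed
  have poly_p: "poly p k = 0 \<longleftrightarrow> k \<in> K" for k
    using finK by (auto simp: p_def poly_prod)
  \<comment> \<open>The descent starts at the coarsest relation, to which every function is
    local.\<close>
  have XX: "equiv X (X \<times> X)" by (rule equivI) (auto intro: refl_onI symI transI)
  have loc: "local_to X (X \<times> X) f"
  proof (rule local_toI)
    fix C C' assume "linear_order_on X C" "linear_order_on X C'" "C \<inter> X \<times> X = C' \<inter> X \<times> X"
    then show "f C = f C'" using linear_order_onD(1)[of X C] linear_order_onD(1)[of X C']
      by (simp add: Int_absorb2)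
  qed
  have pw: "annihilates (p ^ Suc (card (X \<times> X))) f"
    by (rule power_annihilates[OF _ XX loc]) (auto simp: poly_p K_def)
  have "annihilates (\<Prod>k\<in>A. [:-k, 1:]) f"
    by (rule squarefree_annihilates[OF XX loc finA]) (auto simp: A_def)
  moreover have "(\<Prod>k\<in>A. [:-k, 1:]) = p * (\<Prod>k\<in>A - K. [:-k, 1:])"
    unfolding p_def using prod.subset_diff[OF KA finA, of "\<lambda>k. [:-k, 1:]"] by (simp add: mult.commute)
  moreover have "annihilates p f" if "finite B" "B \<inter> K = {}" "annihilates (p * (\<Prod>k\<in>B. [:-k, 1:])) f" for B
    using that
  proof (induction B)
    case (insert b B)
    have "annihilates (p * (\<Prod>k\<in>B. [:-k, 1:])) f"
    proof (rule annihilates_cancel_factor[OF _ pw])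
      show "annihilates (p * (\<Prod>k\<in>B. [:- k, 1:]) * [:- b, 1:]) f"
        using insert.prems(2) insert.hyps by (simp add: mult_ac)
      show "poly (p ^ Suc (card (X \<times> X))) b \<noteq> 0"
        using insert.prems(1) poly_p[of b] by (simp del: power_Suc)
    qed
    then show ?case using insert by auto
  qed simp
  ultimately show ?thesis using finA by (auto simp: p_def K_def)
qed

end

section \<open>Set compositions as total preorders\<close>

definition face_order :: "nat set list \<Rightarrow> nat rel" where
  "face_order F = {(x, y). \<exists>i j. i \<le> j \<and> j < length F \<and> x \<in> F ! i \<and> y \<in> F ! j}"

lemma set_compositions_disjoint:
  assumes "F \<in> set_compositions n" "i < length F" "j < length F" "x \<in> F ! i" "x \<in> F ! j"
  shows "i = j"
proof -
  have "sorted_wrt disjnt F" using assms(1) by (simp add: set_compositions_def)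
  then have "disjnt (F ! i) (F ! j)" if "i < j" "j < length F" for i j
    using that by (simp add: sorted_wrt_iff_nth_less)
  then show ?thesis using assms(2-) by (metis disjnt_iff linorder_neqE_nat)
qed

lemma set_compositions_cover:
  assumes "F \<in> set_compositions n" "x \<in> {1..n}"
  obtains i where "i < length F" "x \<in> F ! i"
proof -
  have "x \<in> \<Union> (set F)" using assms by (auto simp: set_compositions_def)
  then show ?thesis using that by (auto simp: in_set_conv_nth)
qed

lemma set_compositions_block:
  assumes "F \<in> set_compositions n" "i < length F"
  shows "F ! i \<subseteq> {1..n}" "F ! i \<noteq> {}" "finite (F ! i)"
proof -
  have mem: "F ! i \<in> set F" using assms(2) by simp
  have sc: "\<Union> (set F) = {1..n}" "{} \<notin> set F" using assms(1) by (simp_all add: set_compositions_def)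
  show sub: "F ! i \<subseteq> {1..n}" using mem sc(1) by blast
  show "F ! i \<noteq> {}" using mem sc(2) by metis
  show "finite (F ! i)" using sub by (rule finite_subset) simp
qed

lemma face_order_iff:
  assumes "F \<in> set_compositions n" "i < length F" "j < length F" "x \<in> F ! i" "y \<in> F ! j"
  shows "(x, y) \<in> face_order F \<longleftrightarrow> i \<le> j"
proof
  assume "(x, y) \<in> face_order F"
  then obtain i' j' where ij: "i' \<le> j'" "j' < length F" "x \<in> F ! i'" "y \<in> F ! j'"
    by (auto simp: face_order_def)
  have "i' = i" "j' = j"
    using set_compositions_disjoint[OF assms(1)] ij assms(2-) by auto
  then show "i \<le> j" using ij by simp
qed (use assms in \<open>auto simp: face_order_def\<close>)

lemma total_preorder_face_order:
  assumes F: "F \<in> set_compositions n"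
  shows "total_preorder_on {1..n} (face_order F)"
proof (rule total_preorder_onI)
  show "face_order F \<subseteq> {1..n} \<times> {1..n}"
  proof (rule subrelI)
    fix x y assume "(x, y) \<in> face_order F"
    then obtain i j where "i \<le> j" "j < length F" "x \<in> F ! i" "y \<in> F ! j"
      by (auto simp: face_order_def)
    then show "(x, y) \<in> {1..n} \<times> {1..n}"
      using set_compositions_block(1)[OF F, of i] set_compositions_block(1)[OF F, of j] by auto
  qed
  show "(x, x) \<in> face_order F" if "x \<in> {1..n}" for x
    by (rule set_compositions_cover[OF F that]) (auto simp: face_order_def)
  show "(x, z) \<in> face_order F" if xy: "(x, y) \<in> face_order F" and yz: "(y, z) \<in> face_order F" for x y z
  proof -
    obtain i j where ij: "i \<le> j" "j < length F" "x \<in> F ! i" "y \<in> F ! j"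
      using xy by (auto simp: face_order_def)
    obtain k l where kl: "k \<le> l" "l < length F" "y \<in> F ! k" "z \<in> F ! l"
      using yz by (auto simp: face_order_def)
    have "j = k" using set_compositions_disjoint[OF F, of j k y] ij kl by simp
    then have "i \<le> l" using ij(1) kl(1) by simp
    then show ?thesis using ij(3) kl(2,4) unfolding face_order_def by blast
  qed
  show "(x, y) \<in> face_order F \<or> (y, x) \<in> face_order F" if x: "x \<in> {1..n}" and y: "y \<in> {1..n}" for x y
  proof -
    obtain i where i: "i < length F" "x \<in> F ! i" by (rule set_compositions_cover[OF F x])
    obtain j where j: "j < length F" "y \<in> F ! j" by (rule set_compositions_cover[OF F y])
    show ?thesis
      using face_order_iff[OF F i(1) j(1) i(2) j(2)] face_order_iff[OF F j(1) i(1) j(2) i(2)] by auto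
  qed
qed

section \<open>Equivalence relations as supports of set compositions\<close>

text \<open>The support of the face \<open>F\<close>, forgetting the order of its blocks;
  \<open>n_tilde_family\<close> depends on \<open>F\<close> only through it.\<close>

definition same_block :: "nat set list \<Rightarrow> nat rel" where
  "same_block F = (\<Union>B\<in>set F. B \<times> B)"

lemma equiv_same_block:
  assumes F: "F \<in> set_compositions n"
  shows "equiv {1..n} (same_block F)"
proof (rule equivI)
  show "same_block F \<subseteq> {1..n} \<times> {1..n}"
    using F by (auto simp: set_compositions_def same_block_def)
  show "refl_on {1..n} (same_block F)"
    using F by (intro refl_onI) (auto simp: set_compositions_def same_block_def)
  show "sym (same_block F)" by (auto intro: symI simp: same_block_def)
  show "trans (same_block F)"
  proof (rule transI)
    fix x y z assume "(x, y) \<in> same_block F" "(y, z) \<in> same_block F"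
    then obtain i j where "i < length F" "j < length F" "x \<in> F ! i" "y \<in> F ! i" "y \<in> F ! j" "z \<in> F ! j"
      by (auto simp: same_block_def in_set_conv_nth)
    then show "(x, z) \<in> same_block F"
      using set_compositions_disjoint[OF F, of i j y] by (auto simp: same_block_def intro!: bexI[of _ "F ! i"])
  qed
qed

lemma quotient_same_block:
  assumes F: "F \<in> set_compositions n"
  shows "{1..n} // same_block F = set F"
proof -
  have cls: "same_block F `` {x} = F ! i" if "i < length F" "x \<in> F ! i" for i x
  proof (intro equalityI subsetI)
    fix y assume "y \<in> same_block F `` {x}"
    then obtain j where "j < length F" "x \<in> F ! j" "y \<in> F ! j"
      by (auto simp: same_block_def in_set_conv_nth)
    then show "y \<in> F ! i" using set_compositions_disjoint[OF F that(1) _ that(2), of j] by simp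
  next
    fix y assume "y \<in> F ! i"
    then show "y \<in> same_block F `` {x}" using that by (auto simp: same_block_def intro!: bexI[of _ "F ! i"])
  qed
  show ?thesis
  proof (intro equalityI subsetI)
    fix Q assume "Q \<in> {1..n} // same_block F"
    then obtain x where x: "x \<in> {1..n}" "Q = same_block F `` {x}" by (auto elim: quotientE)
    obtain i where "i < length F" "x \<in> F ! i" by (rule set_compositions_cover[OF F x(1)])
    then show "Q \<in> set F" using cls x(2) by simp
  next
    fix Q assume "Q \<in> set F"
    then obtain i where i: "i < length F" "Q = F ! i" by (auto simp: in_set_conv_nth)
    then obtain x where x: "x \<in> F ! i" using set_compositions_block(2)[OF F i(1)] by auto
    then have "x \<in> {1..n}" using set_compositions_block(1)[OF F i(1)] by auto
    then show "Q \<in> {1..n} // same_block F" using cls[OF i(1) x] i(2) by (metis quotientI)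
  qed
qed

lemma distinct_set_composition:
  assumes F: "F \<in> set_compositions n"
  shows "distinct F"
  unfolding distinct_conv_nth
proof (intro allI impI)
  fix i j assume ij: "i < length F" "j < length F" "i \<noteq> j"
  obtain x where "x \<in> F ! i" using set_compositions_block(2)[OF F ij(1)] by auto
  then show "F ! i \<noteq> F ! j" using set_compositions_disjoint[OF F ij(1,2)] ij(3) by auto
qed

text \<open>The classes may be listed in any order. Thus the values over set compositions exhaust
  the values over all equivalence relations.\<close>

lemma equiv_eq_same_block:
  assumes e: "equiv {1..n} e"
  obtains F where "F \<in> set_compositions n" "same_block F = e"
proof -
  obtain F where F: "set F = {1..n} // e" "distinct F"
    using finite_distinct_list[OF finite_quotient[of "{1..n}" e]] equivD(1)[OF e] by auto
  have "sorted_wrt disjnt F"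
    unfolding sorted_wrt_iff_nth_less
  proof (intro allI impI)
    fix i j assume ij: "i < j" "j < length F"
    then have "F ! i \<in> {1..n} // e" "F ! j \<in> {1..n} // e"
      using nth_mem[of i F] nth_mem[of j F] by (simp_all only: F(1) less_trans)
    moreover have "F ! i \<noteq> F ! j" using ij F(2) by (simp add: nth_eq_iff_index_eq)
    ultimately show "disjnt (F ! i) (F ! j)" using quotient_disj[OF e] by (auto simp: disjnt_def)
  qed
  moreover have "{} \<notin> set F" using in_quotient_imp_non_empty[OF e] F(1) by auto
  moreover have "\<Union> (set F) = {1..n}" using Union_quotient[OF e] F(1) by simp
  ultimately have SC: "F \<in> set_compositions n" by (simp add: set_compositions_def)
  have "same_block F = e"
  proof (intro equalityI subrelI)
    fix x y assume "(x, y) \<in> same_block F"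
    then obtain B where "B \<in> {1..n} // e" "x \<in> B" "y \<in> B" by (auto simp: same_block_def F(1))
    then show "(x, y) \<in> e" using in_quotient_imp_in_rel[OF e] by auto
  next
    fix x y assume xy: "(x, y) \<in> e"
    then have "x \<in> {1..n}" using equivD(1)[OF e] by auto
    then have "e `` {x} \<in> set F" "x \<in> e `` {x}" "y \<in> e `` {x}"
      using xy equivD(2)[OF e] by (auto simp: F(1) intro: quotientI)
    then show "(x, y) \<in> same_block F" by (auto simp: same_block_def)
  qed
  with SC show ?thesis by (rule that)
qed

text \<open>As \<open>same_block F\<close> is symmetric, the inclusion forces its pairs to be ties
  of \<open>face_order G\<close>, that is, to share a block of \<open>G\<close>. This translates the
  counts \<open>n_comp\<close> into weights.\<close>

lemma blocks_refine_iff: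
  assumes F: "F \<in> set_compositions n" and G: "G \<in> set_compositions n"
  shows "F \<preceq>\<^sub>b G \<longleftrightarrow> same_block F \<subseteq> face_order G"
proof
  assume *: "F \<preceq>\<^sub>b G"
  show "same_block F \<subseteq> face_order G"
  proof (rule subrelI)
    fix x y assume "(x, y) \<in> same_block F"
    then obtain B where "B \<in> set F" "x \<in> B" "y \<in> B" by (auto simp: same_block_def)
    moreover from this obtain Y where "Y \<in> set G" "B \<subseteq> Y" using * by (auto simp: blocks_refine_def)
    ultimately obtain i where "i < length G" "x \<in> G ! i" "y \<in> G ! i"
      by (metis in_set_conv_nth subsetD)
    then show "(x, y) \<in> face_order G" by (auto simp: face_order_def)
  qed
next
  assume *: "same_block F \<subseteq> face_order G"
  show "F \<preceq>\<^sub>b G"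
    unfolding blocks_refine_def
  proof
    fix B assume B: "B \<in> set F"
    have Bn: "B \<subseteq> {1..n}" using F B by (auto simp: set_compositions_def)
    have "B \<noteq> {}" using F B by (metis (mono_tags, lifting) mem_Collect_eq set_compositions_def)
    then obtain x where x: "x \<in> B" by auto
    obtain i where i: "i < length G" "x \<in> G ! i"
      by (rule set_compositions_cover[OF G, of x]) (use x Bn in auto)
    have "y \<in> G ! i" if y: "y \<in> B" for y
    proof -
      have "(x, y) \<in> same_block F" "(y, x) \<in> same_block F" using B x y by (auto simp: same_block_def)
      then have xy: "(x, y) \<in> face_order G" "(y, x) \<in> face_order G" using * by auto
      obtain j where j: "j < length G" "y \<in> G ! j"
        by (rule set_compositions_cover[OF G, of y]) (use y Bn in auto)
      have "i = j"
        using xy face_order_iff[OF G i(1) j(1) i(2) j(2)] face_order_iff[OF G j(1) i(1) j(2) i(2)] by auto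
      then show ?thesis using j by simp
    qed
    then show "\<exists>Y\<in>set G. B \<subseteq> Y" using i(1) by (intro bexI[of _ "G ! i"]) auto
  qed
qed

lemma card_Union_take:
  assumes F: "F \<in> set_compositions n" and "j \<le> length F"
  shows "card (\<Union> (set (take j F))) = sum_list (take j (set_comp_type F))"
  using assms(2)
proof (induction j)
  case (Suc j)
  have j: "j < length F" using Suc.prems by simp
  have un: "\<Union> (set (take (Suc j) F)) = \<Union> (set (take j F)) \<union> F ! j"
    using j by (simp add: take_Suc_conv_app_nth Un_commute)
  have disj: "\<Union> (set (take j F)) \<inter> F ! j = {}"
  proof -
    have "x \<notin> F ! j" if x: "x \<in> \<Union> (set (take j F))" for x
    proof -
      obtain i where "i < j" "x \<in> F ! i" using x j by (auto simp: in_set_conv_nth)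
      then show ?thesis using set_compositions_disjoint[OF F, of i j x] j by auto
    qed
    then show ?thesis by auto
  qed
  have "finite (\<Union> (set (take j F)))"
    using set_compositions_block(3)[OF F] j by (intro finite_Union) (auto simp: in_set_conv_nth)
  then have "card (\<Union> (set (take (Suc j) F))) = card (\<Union> (set (take j F))) + card (F ! j)"
    unfolding un using disj set_compositions_block(3)[OF F j] by (intro card_Un_disjoint) auto
  then show ?case using Suc j by (simp add: take_Suc_conv_app_nth set_comp_type_def)
qed simp

lemma set_comp_type_in_compositions:
  assumes F: "F \<in> set_compositions n"
  shows "set_comp_type F \<in> compositions n"
proof -
  have "\<Union> (set F) = {1..n}" using F by (simp add: set_compositions_def)
  then have "sum_list (set_comp_type F) = n"
    using card_Union_take[OF F order_refl] by (simp add: set_comp_type_def)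
  moreover have "0 < card B" if "B \<in> set F" for B
    using that set_compositions_block(2,3)[OF F] by (auto simp: in_set_conv_nth card_gt_0_iff)
  ultimately show ?thesis by (auto simp: compositions_def set_comp_type_def)
qed

lemma weighted_preorders_set_compositions:
  fixes \<gamma> :: "nat list \<Rightarrow> 'k::linordered_field"
  assumes "\<And>\<alpha>. \<alpha> \<in> compositions n \<Longrightarrow> 0 \<le> \<gamma> \<alpha>"
  shows "weighted_preorders {1..n} (set_compositions n) face_order (\<lambda>F. \<gamma> (set_comp_type F))"
  using assms by unfold_locales
    (simp_all add: finite_set_compositions total_preorder_face_order set_comp_type_in_compositions
      del: One_nat_def)

text \<open>Group the faces contributing to the weight by type: the group of type
  \<open>\<alpha>\<close> has \<open>n_comp n \<alpha> F\<close> members of equal weight. The signs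
  agree since the classes are the \<open>length F\<close> distinct blocks.\<close>

lemma n_tilde_family_eq_signed_weight:
  fixes \<gamma> :: "nat list \<Rightarrow> 'k::linordered_field"
  assumes \<gamma>: "\<And>\<alpha>. \<alpha> \<in> compositions n \<Longrightarrow> 0 \<le> \<gamma> \<alpha>" and F: "F \<in> set_compositions n"
  shows "n_tilde_family n \<gamma> F =
    weighted_preorders.signed_weight {1..n} (set_compositions n) face_order
      (\<lambda>F. \<gamma> (set_comp_type F)) (same_block F)"
proof -
  interpret weighted_preorders "{1..n}" "set_compositions n" face_order "\<lambda>F. \<gamma> (set_comp_type F)"
    by (rule weighted_preorders_set_compositions[OF \<gamma>])
  let ?S = "{G \<in> set_compositions n. same_block F \<subseteq> face_order G}"
  have "weight (same_block F) =
      (\<Sum>\<alpha>\<in>compositions n. \<Sum>G\<in>{G \<in> ?S. set_comp_type G = \<alpha>}. \<gamma> (set_comp_type G))"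
    unfolding weight_def
    by (rule sum.group[symmetric])
       (auto simp: finite_set_compositions finite_compositions set_comp_type_in_compositions)
  also have "\<dots> = (\<Sum>\<alpha>\<in>compositions n. \<gamma> \<alpha> * of_nat (n_comp n \<alpha> F))"
  proof (intro sum.cong refl)
    fix \<alpha>
    have "{G \<in> ?S. set_comp_type G = \<alpha>} = {G \<in> set_compositions n. F \<preceq>\<^sub>b G \<and> set_comp_type G = \<alpha>}"
      using blocks_refine_iff[OF F] by auto
    then show "(\<Sum>G\<in>{G \<in> ?S. set_comp_type G = \<alpha>}. \<gamma> (set_comp_type G)) = \<gamma> \<alpha> * of_nat (n_comp n \<alpha> F)"
      by (simp add: n_comp_def mult.commute)
  qed
  finally show ?thesis
    using distinct_set_composition[OF F]
    by (simp add: n_tilde_family_def n_tilde_comp_def signed_weight_def quotient_same_block[OF F]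
        distinct_card sum_distrib_left mult_ac del: One_nat_def)
qed

section \<open>Permutations as linear orders\<close>

text \<open>One-line notation read as an order on the values, so that right multiplication
  rearranges positions while faces compare values.\<close>

definition perm_order :: "nat \<Rightarrow> (nat \<Rightarrow> nat) \<Rightarrow> nat rel" where
  "perm_order n w = {(w i, w j) | i j. i \<in> {1..n} \<and> j \<in> {1..n} \<and> i \<le> j}"

lemma perm_order_iff:
  assumes "w \<in> carrier (sym_group n)" "i \<in> {1..n}" "j \<in> {1..n}"
  shows "(w i, w j) \<in> perm_order n w \<longleftrightarrow> i \<le> j"
  using assms permutes_inj[of w "{1..n}"] by (auto simp: perm_order_def sym_group_carrier inj_eq)

lemma linear_order_perm_order:
  assumes "w \<in> carrier (sym_group n)"
  shows "linear_order_on {1..n} (perm_order n w)"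
proof -
  have w: "w permutes {1..n}" using assms by (simp add: sym_group_carrier)
  have pre: "\<exists>i\<in>{1..n}. x = w i" if "x \<in> {1..n}" for x
    using permutes_image[OF w] that by (metis imageE)
  have inj: "w i = w j \<longleftrightarrow> i = j" for i j using permutes_inj[OF w] by (simp add: inj_eq)
  show ?thesis
  proof (rule linear_order_onI)
    show "perm_order n w \<subseteq> {1..n} \<times> {1..n}"
      using permutes_in_image[OF w] by (auto simp: perm_order_def simp del: atLeastAtMost_iff)
    show "(x, y) \<in> perm_order n w \<or> (y, x) \<in> perm_order n w" if "x \<in> {1..n}" "y \<in> {1..n}" for x y
      using pre[OF that(1)] pre[OF that(2)] by (auto simp: perm_order_iff[OF assms])
    show "(x, x) \<in> perm_order n w" if "x \<in> {1..n}" for x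
      using pre[OF that] by (auto simp: perm_order_iff[OF assms])
    show "(x, z) \<in> perm_order n w" if "(x, y) \<in> perm_order n w" "(y, z) \<in> perm_order n w" for x y z
      using that inj by (fastforce simp: perm_order_def)
    show "x = y" if "(x, y) \<in> perm_order n w" "(y, x) \<in> perm_order n w" for x y
      using that inj by (fastforce simp: perm_order_def)
  qed
qed

lemma linear_order_eqI:
  assumes "linear_order_on X C" "linear_order_on X C'" "C \<subseteq> C'"
  shows "C = C'"
proof -
  have "equiv X (X \<times> X)" by (rule equivI) (auto intro: refl_onI symI transI)
  from linear_order_Int_eqI[OF assms(1,2) _ this] show ?thesis
    using linear_order_onD(1)[OF assms(1)] linear_order_onD(1)[OF assms(2)] assms(3) by blast
qed

text \<open>The permutation is the inverse of the rank function of \<open>C\<close>.\<close>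

lemma linear_order_eq_perm_order:
  assumes C: "linear_order_on {1..n} C"
  obtains v where "v \<in> carrier (sym_group n)" "C = perm_order n v"
proof -
  define r where "r x = card {y. (y, x) \<in> C}" for x
  note rank = linear_order_rank[OF _ C, folded r_def, simplified]
  \<comment> \<open>Outside \<open>{1..n}\<close> the function must be the identity, as
    \<open>permutes\<close> demands.\<close>
  define v where "v i = (if i \<in> {1..n} then inv_into {1..n} r i else i)" for i
  have img: "r ` {1..n} = {1..n}"
    using rank(2,3) by (intro card_subset_eq) (auto simp: card_image)
  then have r: "bij_betw r {1..n} {1..n}" using rank(2) by (simp add: bij_betw_def)
  have "bij_betw v {1..n} {1..n}"
    using bij_betw_inv_into[OF r] by (subst bij_betw_cong[of _ _ "inv_into {1..n} r"]) (auto simp: v_def)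
  then have "v permutes {1..n}" by (rule bij_imp_permutes) (unfold v_def, simp only: if_False)
  then have v: "v \<in> carrier (sym_group n)" by (simp add: sym_group_carrier)
  have rv: "r (v i) = i" if "i \<in> {1..n}" for i
    using that img by (simp add: v_def f_inv_into_f)
  have vn: "v i \<in> {1..n}" if "i \<in> {1..n}" for i
    using that permutes_in_image[OF \<open>v permutes {1..n}\<close>] by blast
  have "perm_order n v \<subseteq> C"
  proof (rule subrelI)
    fix x y assume "(x, y) \<in> perm_order n v"
    then obtain i j where "x = v i" "y = v j" "i \<in> {1..n}" "j \<in> {1..n}" "i \<le> j"
      by (auto simp: perm_order_def)
    then show "(x, y) \<in> C" using rv vn by (subst rank(1)) auto
  qed
  then have "C = perm_order n v"
    using linear_order_eqI[OF linear_order_perm_order[OF v] C] by simp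
  with v show ?thesis by (rule that)
qed

lemma down_closed_eq_atLeastAtMost:
  assumes "A \<subseteq> {1..n::nat}" "\<And>i j. i \<in> A \<Longrightarrow> 1 \<le> j \<Longrightarrow> j \<le> i \<Longrightarrow> j \<in> A"
  shows "A = {1..card A}"
proof (cases "A = {}")
  case False
  have fin: "finite A" using assms(1) by (rule finite_subset) simp
  have "A = {1..Max A}"
    using assms(1) assms(2)[OF Max_in[OF fin False]] Max_ge[OF fin] by force
  then show ?thesis by (metis card_atLeastAtMost diff_Suc_1 add_Suc_right add.right_neutral One_nat_def)
qed simp

text \<open>The quotient \<open>g\<close> of the two permutations is an order automorphism of
  \<open>{1..n}\<close>; it maps initial segments to initial segments of the same size and is
  therefore the identity.\<close>

lemma perm_order_inj:
  assumes v: "v \<in> carrier (sym_group n)" and w: "w \<in> carrier (sym_group n)"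
    and eq: "perm_order n v = perm_order n w"
  shows "v = w"
proof -
  have vp: "v permutes {1..n}" and wp: "w permutes {1..n}" using v w by (simp_all add: sym_group_carrier)
  define g where "g = Hilbert_Choice.inv w \<circ> v"
  have gp: "g permutes {1..n}" unfolding g_def by (intro permutes_compose vp permutes_inv wp)
  have wg: "w (g i) = v i" for i using permutes_inverses(1)[OF wp] by (simp add: g_def)
  have gn: "g i \<in> {1..n}" if "i \<in> {1..n}" for i using permutes_in_image[OF gp] that by blast
  have mono: "g i \<le> g j \<longleftrightarrow> i \<le> j" if "i \<in> {1..n}" "j \<in> {1..n}" for i j
    using perm_order_iff[OF v that] perm_order_iff[OF w gn[OF that(1)] gn[OF that(2)]] eq wg by simp
  have "g i = i" if i: "i \<in> {1..n}" for i
  proof -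
    have "g ` {1..i} = {1..g i}"
    proof (intro equalityI subsetI)
      fix x assume "x \<in> g ` {1..i}"
      then show "x \<in> {1..g i}" using i mono gn by fastforce
    next
      fix x assume x: "x \<in> {1..g i}"
      then have "x \<in> {1..n}" using gn[OF i] by auto
      then obtain j where j: "j \<in> {1..n}" "x = g j" using permutes_image[OF gp] by (metis imageE)
      then have "j \<le> i" using mono[OF j(1) i] x by simp
      then show "x \<in> g ` {1..i}" using j by auto
    qed
    then have "card {1..i} = card {1..g i}" using permutes_inj_on[OF gp] by (metis card_image)
    then show ?thesis by simp
  qed
  then have "v i = w i" if "i \<in> {1..n}" for i using wg[of i] that by simp
  moreover have "v i = w i" if "i \<notin> {1..n}" for i
    using permutes_not_in[OF vp that] permutes_not_in[OF wp that] by simp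
  ultimately show ?thesis by blast
qed

lemma perm_order_w0:
  assumes u: "u \<in> carrier (sym_group n)"
  shows "perm_order n (u \<circ> w0 n) = (perm_order n u)\<inverse>"
proof (rule linear_order_eqI)
  show "linear_order_on {1..n} (perm_order n (u \<circ> w0 n))"
    by (intro linear_order_perm_order sym_comp_closed u w0_in_sym_group)
  show "linear_order_on {1..n} ((perm_order n u)\<inverse>)"
    using linear_order_perm_order[OF u] by simp
  show "perm_order n (u \<circ> w0 n) \<subseteq> (perm_order n u)\<inverse>"
  proof (rule subrelI)
    fix x y assume "(x, y) \<in> perm_order n (u \<circ> w0 n)"
    then obtain i j where ij: "x = u (w0 n i)" "y = u (w0 n j)" "i \<in> {1..n}" "j \<in> {1..n}" "i \<le> j"
      by (auto simp: perm_order_def)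
    moreover have "w0 n i \<in> {1..n}" "w0 n j \<in> {1..n}" "w0 n j \<le> w0 n i"
      using ij by (auto simp: w0_def)
    ultimately show "(x, y) \<in> (perm_order n u)\<inverse>" using perm_order_iff[OF u] by auto
  qed
qed

section \<open>Faces of a given type and descents\<close>

definition psum :: "nat list \<Rightarrow> nat \<Rightarrow> nat" where
  "psum \<alpha> j = sum_list (take j \<alpha>)"

text \<open>The only face of type \<open>\<alpha>\<close> that can produce the order of
  \<open>v\<close> from another order: the one-line word of \<open>v\<close> cut into consecutive
  segments.\<close>

definition blocks_of :: "nat list \<Rightarrow> (nat \<Rightarrow> nat) \<Rightarrow> nat set list" where
  "blocks_of \<alpha> v = map (\<lambda>j. v ` {psum \<alpha> j<..psum \<alpha> (Suc j)}) [0..<length \<alpha>]"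

lemma psum_Suc: "j < length \<alpha> \<Longrightarrow> psum \<alpha> (Suc j) = psum \<alpha> j + \<alpha> ! j"
  by (simp add: psum_def take_Suc_conv_app_nth)

lemma psum_0 [simp]: "psum \<alpha> 0 = 0"
  by (simp add: psum_def)

lemma psum_length: "\<alpha> \<in> compositions n \<Longrightarrow> psum \<alpha> (length \<alpha>) = n"
  by (simp add: psum_def compositions_def)

lemma psum_mono:
  assumes "i \<le> j" "j \<le> length \<alpha>"
  shows "psum \<alpha> i \<le> psum \<alpha> j"
  using assms by (induction j rule: dec_induct) (auto simp: psum_Suc)

lemma interval_index:
  assumes \<alpha>: "\<alpha> \<in> compositions n" and i: "i \<in> {1..n}"
  obtains a where "a < length \<alpha>" "i \<in> {psum \<alpha> a<..psum \<alpha> (Suc a)}"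
proof -
  define a where "a = (LEAST a. i \<le> psum \<alpha> (Suc a))"
  have len: "length \<alpha> \<noteq> 0" using psum_length[OF \<alpha>] i by (cases \<alpha>) auto
  have ex: "i \<le> psum \<alpha> (Suc (length \<alpha> - 1))" using psum_length[OF \<alpha>] i len by simp
  have a: "i \<le> psum \<alpha> (Suc a)" unfolding a_def by (rule LeastI[of "\<lambda>a. i \<le> psum \<alpha> (Suc a)", OF ex])
  have al: "a < length \<alpha>"
    using Least_le[of "\<lambda>a. i \<le> psum \<alpha> (Suc a)", OF ex] len unfolding a_def by linarith
  have "psum \<alpha> a < i"
  proof (cases a)
    case 0
    then show ?thesis using i by simp
  next
    case (Suc b)
    then have "\<not> i \<le> psum \<alpha> (Suc b)"
      using not_less_Least[of b "\<lambda>a. i \<le> psum \<alpha> (Suc a)"] unfolding a_def by simp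
    then show ?thesis using Suc by simp
  qed
  with a al show ?thesis by (intro that) auto
qed

lemma interval_less:
  assumes "a < b" "b < length \<alpha>" "i \<in> {psum \<alpha> a<..psum \<alpha> (Suc a)}" "j \<in> {psum \<alpha> b<..psum \<alpha> (Suc b)}"
  shows "i < j"
  using psum_mono[of "Suc a" b \<alpha>] assms by auto

lemma partial_sums_interval:
  assumes "a < length \<alpha>" "psum \<alpha> a < i" "i < psum \<alpha> (Suc a)"
  shows "i \<notin> partial_sums \<alpha>"
proof
  assume "i \<in> partial_sums \<alpha>"
  then obtain j where j: "i = psum \<alpha> j" "j < length \<alpha>" by (auto simp: partial_sums_def psum_def)
  then show False using psum_mono[of j a \<alpha>] psum_mono[of "Suc a" j \<alpha>] assms by (cases "j \<le> a") auto
qed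

lemma blocks_of_set_composition:
  assumes \<alpha>: "\<alpha> \<in> compositions n" and v: "v \<in> carrier (sym_group n)"
  shows "blocks_of \<alpha> v \<in> set_compositions n" and "set_comp_type (blocks_of \<alpha> v) = \<alpha>"
proof -
  have vp: "v permutes {1..n}" using v by (simp add: sym_group_carrier)
  have inj: "v i = v j \<longleftrightarrow> i = j" for i j using permutes_inj[OF vp] by (simp add: inj_eq)
  have pos: "0 < \<alpha> ! j" if "j < length \<alpha>" for j using that \<alpha> by (simp add: compositions_def)
  have "sorted_wrt disjnt (blocks_of \<alpha> v)"
    unfolding sorted_wrt_iff_nth_less
  proof (intro allI impI)
    fix a b assume ab: "a < b" "b < length (blocks_of \<alpha> v)"
    then have bl: "b < length \<alpha>" by (simp add: blocks_of_def)
    have "i \<noteq> j" if "i \<in> {psum \<alpha> a<..psum \<alpha> (Suc a)}" "j \<in> {psum \<alpha> b<..psum \<alpha> (Suc b)}" for i j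
      using interval_less[OF ab(1) bl that] by simp
    then show "disjnt (blocks_of \<alpha> v ! a) (blocks_of \<alpha> v ! b)"
      using ab bl by (fastforce simp: blocks_of_def disjnt_iff inj)
  qed
  moreover have "{} \<notin> set (blocks_of \<alpha> v)"
    using pos by (auto simp: blocks_of_def psum_Suc)
  moreover have "\<Union> (set (blocks_of \<alpha> v)) = {1..n}"
  proof -
    have "(\<Union>j\<in>{..<length \<alpha>}. {psum \<alpha> j<..psum \<alpha> (Suc j)}) = {1..n}"
    proof (intro equalityI subsetI)
      fix i assume "i \<in> (\<Union>j\<in>{..<length \<alpha>}. {psum \<alpha> j<..psum \<alpha> (Suc j)})"
      then obtain j where j: "j < length \<alpha>" "psum \<alpha> j < i" "i \<le> psum \<alpha> (Suc j)" by auto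
      then show "i \<in> {1..n}" using psum_mono[of "Suc j" "length \<alpha>" \<alpha>] psum_length[OF \<alpha>] by auto
    next
      fix i assume i: "i \<in> {1..n}"
      show "i \<in> (\<Union>j\<in>{..<length \<alpha>}. {psum \<alpha> j<..psum \<alpha> (Suc j)})"
        by (rule interval_index[OF \<alpha> i]) auto
    qed
    moreover have "\<Union> (set (blocks_of \<alpha> v)) = v ` (\<Union>j\<in>{..<length \<alpha>}. {psum \<alpha> j<..psum \<alpha> (Suc j)})"
      by (simp add: blocks_of_def image_UN atLeast0LessThan)
    ultimately show ?thesis using permutes_image[OF vp] by simp
  qed
  ultimately show "blocks_of \<alpha> v \<in> set_compositions n" by (simp add: set_compositions_def)
  show "set_comp_type (blocks_of \<alpha> v) = \<alpha>"
    unfolding set_comp_type_def blocks_of_def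
    by (rule nth_equalityI) (simp_all add: card_image[OF inj_on_subset[OF permutes_inj[OF vp]]] psum_Suc)
qed

text \<open>\<open>w\<close> descends only at the cuts of \<open>\<alpha>\<close>, hence increases
  on each segment. So inside a block the word of \<open>u \<circ> w\<close> lists its values in the
  order of \<open>u\<close>, just as the tie-breaking does.\<close>

lemma lex_order_blocks_of:
  assumes \<alpha>: "\<alpha> \<in> compositions n" and u: "u \<in> carrier (sym_group n)"
    and w: "w \<in> carrier (sym_group n)" and des: "Des n w \<subseteq> partial_sums \<alpha>"
  shows "lex_order (face_order (blocks_of \<alpha> (u \<circ> w))) (perm_order n u) = perm_order n (u \<circ> w)"
proof -
  let ?v = "u \<circ> w" and ?F = "blocks_of \<alpha> (u \<circ> w)"
  have wp: "w permutes {1..n}" using w by (simp add: sym_group_carrier)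
  have v: "?v \<in> carrier (sym_group n)" by (rule sym_comp_closed[OF u w])
  note F = blocks_of_set_composition(1)[OF \<alpha> v]
  have len: "length ?F = length \<alpha>" by (simp add: blocks_of_def)
  have nth: "?F ! a = ?v ` {psum \<alpha> a<..psum \<alpha> (Suc a)}" if "a < length \<alpha>" for a
    using that by (simp add: blocks_of_def)
  have w_mono: "w i \<le> w j"
    if a: "a < length \<alpha>" and ij: "psum \<alpha> a < i" "i \<le> j" "j \<le> psum \<alpha> (Suc a)" for a i j
    using ij(2,3)
  proof (induction j rule: dec_induct)
    case (step k)
    have "k < n" using step psum_mono[of "Suc a" "length \<alpha>" \<alpha>] psum_length[OF \<alpha>] a by auto
    moreover have "k \<notin> Des n w"
      using partial_sums_interval[OF a, of k] step ij(1) des by auto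
    ultimately have "w k \<le> w (Suc k)" using step ij(1) by (auto simp: Des_def)
    then show ?case using step by simp
  qed simp
  have "perm_order n ?v \<subseteq> lex_order (face_order ?F) (perm_order n u)"
  proof (rule subrelI)
    fix x y assume "(x, y) \<in> perm_order n ?v"
    then obtain i j where ij: "x = ?v i" "y = ?v j" "i \<in> {1..n}" "j \<in> {1..n}" "i \<le> j"
      by (auto simp: perm_order_def)
    obtain a where a: "a < length \<alpha>" "i \<in> {psum \<alpha> a<..psum \<alpha> (Suc a)}" by (rule interval_index[OF \<alpha> ij(3)])
    obtain b where b: "b < length \<alpha>" "j \<in> {psum \<alpha> b<..psum \<alpha> (Suc b)}" by (rule interval_index[OF \<alpha> ij(4)])
    have xa: "x \<in> ?F ! a" and yb: "y \<in> ?F ! b" using a b ij(1,2) by (simp_all add: nth)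
    have "a \<le> b" using interval_less[OF _ a(1) b(2) a(2)] ij(5) by (meson leD leI)
    moreover have "(x, y) \<in> perm_order n u" if "b \<le> a"
    proof -
      have "a = b" using that \<open>a \<le> b\<close> by simp
      then have "w i \<le> w j" using w_mono[OF a(1), of i j] a(2) b(2) ij(5) by simp
      moreover have "w i \<in> {1..n}" "w j \<in> {1..n}" using permutes_in_image[OF wp] ij(3,4) by blast+
      ultimately show ?thesis using ij(1,2) perm_order_iff[OF u] by simp
    qed
    ultimately show "(x, y) \<in> lex_order (face_order ?F) (perm_order n u)"
      using face_order_iff[OF F _ _ xa yb] face_order_iff[OF F _ _ yb xa] a(1) b(1)
      by (simp add: lex_order_def len)
  qed
  then show ?thesis
    using linear_order_eqI[OF linear_order_perm_order[OF v]
        linear_order_lex_order[OF total_preorder_face_order[OF F] linear_order_perm_order[OF u]]] by simp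
qed

text \<open>The order of \<open>v\<close> refines \<open>face_order F\<close>, so the first
  \<open>j\<close> blocks fill an initial stretch of the word of \<open>v\<close>, whose length is
  fixed by the type. Each block is a difference of two such stretches.\<close>

lemma face_eq_blocks_of:
  assumes F: "F \<in> set_compositions n" and u: "u \<in> carrier (sym_group n)"
    and v: "v \<in> carrier (sym_group n)"
    and lex: "lex_order (face_order F) (perm_order n u) = perm_order n v"
  shows "F = blocks_of (set_comp_type F) v"
proof -
  let ?\<alpha> = "set_comp_type F"
  have len: "length ?\<alpha> = length F" by (simp add: set_comp_type_def)
  have vp: "v permutes {1..n}" using v by (simp add: sym_group_carrier)
  have vinj: "inj v" using permutes_inj[OF vp] .
  have initial: "\<Union> (set (take j F)) = v ` {1..psum ?\<alpha> j}" if j: "j \<le> length F" for j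
  proof -
    define U where "U = \<Union> (set (take j F))"
    \<comment> \<open>The positions occupied by the first \<open>j\<close> blocks; it remains to see
      that they are downward closed.\<close>
    define A where "A = {i \<in> {1..n}. v i \<in> U}"
    have U_iff: "x \<in> U \<longleftrightarrow> (\<exists>a<j. x \<in> F ! a)" for x
      unfolding U_def nth_image[OF j, symmetric] by auto
    have "U \<subseteq> {1..n}"
    proof
      fix x assume "x \<in> U"
      then obtain a where "a < j" "x \<in> F ! a" unfolding U_iff by auto
      then show "x \<in> {1..n}" using set_compositions_block(1)[OF F, of a] j by auto
    qed
    then have "U \<subseteq> v ` {1..n}" using permutes_image[OF vp] by simp
    then have vA: "v ` A = U" unfolding A_def by blast
    have "A = {1..card A}"
    proof (rule down_closed_eq_atLeastAtMost)
      show "A \<subseteq> {1..n}" by (auto simp: A_def)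
      fix i k assume i: "i \<in> A" and k: "1 \<le> k" "k \<le> i"
      have kn: "k \<in> {1..n}" using i k by (auto simp: A_def)
      have "(v k, v i) \<in> perm_order n v" using perm_order_iff[OF v kn, of i] i k by (simp add: A_def)
      then have "(v k, v i) \<in> face_order F" unfolding lex[symmetric] by (simp add: lex_order_def)
      then obtain a b where ab: "a \<le> b" "b < length F" "v k \<in> F ! a" "v i \<in> F ! b"
        by (auto simp: face_order_def)
      obtain b' where b': "b' < j" "v i \<in> F ! b'" using i by (auto simp: A_def U_iff)
      have "b = b'" using set_compositions_disjoint[OF F ab(2) _ ab(4) b'(2)] b' j by simp
      then have "v k \<in> U" unfolding U_iff using ab b' by (intro exI[of _ a]) auto
      then show "k \<in> A" using kn by (simp add: A_def)
    qed
    moreover have "card A = psum ?\<alpha> j"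
      using card_Union_take[OF F j] card_image[OF inj_on_subset[OF vinj subset_UNIV], of A] vA
      by (simp add: U_def psum_def)
    ultimately show ?thesis using vA by (simp add: U_def)
  qed
  have "F ! j = v ` {psum ?\<alpha> j<..psum ?\<alpha> (Suc j)}" if j: "j < length F" for j
  proof -
    have "F ! j = \<Union> (set (take (Suc j) F)) - \<Union> (set (take j F))"
    proof -
      have "x \<notin> \<Union> (set (take j F))" if "x \<in> F ! j" for x
      proof
        assume "x \<in> \<Union> (set (take j F))"
        then obtain i where "i < j" "x \<in> F ! i" using j by (auto simp: in_set_conv_nth)
        then show False using set_compositions_disjoint[OF F, of i j x] j that by auto
      qed
      then show ?thesis using j by (auto simp: take_Suc_conv_app_nth)
    qed
    also have "\<dots> = v ` {1..psum ?\<alpha> (Suc j)} - v ` {1..psum ?\<alpha> j}"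
      using initial[of j] initial[of "Suc j"] j by simp
    also have "\<dots> = v ` ({1..psum ?\<alpha> (Suc j)} - {1..psum ?\<alpha> j})"
      using image_set_diff[OF vinj] by metis
    also have "{1..psum ?\<alpha> (Suc j)} - {1..psum ?\<alpha> j} = {psum ?\<alpha> j<..psum ?\<alpha> (Suc j)}" by auto
    finally show ?thesis .
  qed
  then show ?thesis by (intro nth_equalityI) (simp_all add: blocks_of_def len)
qed

text \<open>Let \<open>v\<close> be the result of \<open>F\<close> acting on \<open>u\<close> and
  \<open>w\<close> the quotient of \<open>v\<close> by \<open>u\<close>. A descent of
  \<open>w\<close> inside a block would contradict that ties of \<open>F\<close> are broken by
  \<open>u\<close>.\<close>

lemma face_in_image_blocks_of:
  assumes F: "F \<in> set_compositions n" and u: "u \<in> carrier (sym_group n)"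
  shows "\<exists>w\<in>carrier (sym_group n). Des n w \<subseteq> partial_sums (set_comp_type F) \<and>
    F = blocks_of (set_comp_type F) (u \<circ> w)"
proof -
  let ?\<alpha> = "set_comp_type F"
  note \<alpha> = set_comp_type_in_compositions[OF F]
  have up: "u permutes {1..n}" using u by (simp add: sym_group_carrier)
  have "linear_order_on {1..n} (lex_order (face_order F) (perm_order n u))"
    by (intro linear_order_lex_order total_preorder_face_order F linear_order_perm_order u)
  then obtain v where v: "v \<in> carrier (sym_group n)"
    and lex: "lex_order (face_order F) (perm_order n u) = perm_order n v"
    by (rule linear_order_eq_perm_order)
  define w where "w = Hilbert_Choice.inv u \<circ> v"
  have w: "w \<in> carrier (sym_group n)"
    unfolding w_def using u v by (simp add: sym_group_carrier permutes_compose permutes_inv)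
  have wp: "w permutes {1..n}" using w by (simp add: sym_group_carrier)
  have uw: "u \<circ> w = v" using permutes_inverses(1)[OF up] by (simp add: w_def fun_eq_iff)
  have Feq: "F = blocks_of ?\<alpha> v" by (rule face_eq_blocks_of[OF F u v lex])
  have "i \<in> partial_sums ?\<alpha>" if i: "i \<in> Des n w" for i
  proof (rule ccontr)
    assume np: "i \<notin> partial_sums ?\<alpha>"
    have i': "i \<in> {1..n}" "Suc i \<in> {1..n}" "w (Suc i) < w i" using i by (auto simp: Des_def)
    obtain a where a: "a < length ?\<alpha>" "i \<in> {psum ?\<alpha> a<..psum ?\<alpha> (Suc a)}"
      by (rule interval_index[OF \<alpha> i'(1)])
    \<comment> \<open>The final partial sum \<open>n\<close> is not in \<open>partial_sums\<close>,
      but a descent position satisfies \<open>Suc i \<le> n\<close> and cannot equal it.\<close>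
    have "i \<noteq> psum ?\<alpha> (Suc a)"
    proof (cases "Suc a < length ?\<alpha>")
      case True
      then show ?thesis using np by (auto simp: partial_sums_def psum_def)
    next
      case False
      then have "psum ?\<alpha> (Suc a) = n" using a(1) psum_length[OF \<alpha>] by (metis Suc_lessI)
      then show ?thesis using i'(2) by auto
    qed
    then have mem: "v i \<in> blocks_of ?\<alpha> v ! a" "v (Suc i) \<in> blocks_of ?\<alpha> v ! a"
      using a by (auto simp: blocks_of_def)
    have al: "a < length F" using a(1) by (simp add: set_comp_type_def)
    have "(v i, v (Suc i)) \<in> perm_order n v" using perm_order_iff[OF v i'(1,2)] by simp
    then have "(v i, v (Suc i)) \<in> perm_order n u"
      using face_order_iff[OF F al al, of "v (Suc i)" "v i"] mem Feq
      unfolding lex[symmetric] by (simp add: lex_order_def)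
    moreover have "w i \<in> {1..n}" "w (Suc i) \<in> {1..n}" using permutes_in_image[OF wp] i'(1,2) by blast+
    ultimately have "w i \<le> w (Suc i)"
      using perm_order_iff[OF u, of "w i" "w (Suc i)"] uw by (simp add: fun_eq_iff)
    then show False using i'(3) by simp
  qed
  then show ?thesis using w Feq uw by auto
qed

text \<open>Cutting \<open>u \<circ> w\<close> into segments is a bijection from the terms
  \<open>w\<close> of \<open>B_comp n \<alpha>\<close> onto the faces of type
  \<open>\<alpha>\<close>, with inverse given by the action on \<open>u\<close>.\<close>

lemma sum_faces_of_type:
  assumes \<alpha>: "\<alpha> \<in> compositions n" and u: "u \<in> carrier (sym_group n)"
  shows "(\<Sum>F\<in>{F \<in> set_compositions n. set_comp_type F = \<alpha>}. f (lex_order (face_order F) (perm_order n u))) =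
    (\<Sum>w\<in>{w \<in> carrier (sym_group n). Des n w \<subseteq> partial_sums \<alpha>}. f (perm_order n (u \<circ> w)))"
proof -
  let ?W = "{w \<in> carrier (sym_group n). Des n w \<subseteq> partial_sums \<alpha>}"
  let ?h = "\<lambda>w. blocks_of \<alpha> (u \<circ> w)"
  have lex: "lex_order (face_order (?h w)) (perm_order n u) = perm_order n (u \<circ> w)" if "w \<in> ?W" for w
    using lex_order_blocks_of[OF \<alpha> u] that by auto
  have "inj u" using u permutes_inj by (auto simp: sym_group_carrier)
  have inj: "inj_on ?h ?W"
  proof (rule inj_onI)
    fix w w' assume w: "w \<in> ?W" and w': "w' \<in> ?W" and eq: "?h w = ?h w'"
    have "perm_order n (u \<circ> w) = perm_order n (u \<circ> w')" using lex[OF w] lex[OF w'] eq by simp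
    then have "u \<circ> w = u \<circ> w'"
      using w w' u by (intro perm_order_inj) (auto intro: sym_comp_closed)
    then show "w = w'" using \<open>inj u\<close> by (simp add: fun_eq_iff inj_eq)
  qed
  have img: "?h ` ?W = {F \<in> set_compositions n. set_comp_type F = \<alpha>}"
  proof (intro equalityI subsetI)
    fix F assume "F \<in> ?h ` ?W"
    then obtain w where "w \<in> carrier (sym_group n)" "F = ?h w" by auto
    then show "F \<in> {F \<in> set_compositions n. set_comp_type F = \<alpha>}"
      using blocks_of_set_composition[OF \<alpha> sym_comp_closed[OF u]] by simp
  next
    fix F assume "F \<in> {F \<in> set_compositions n. set_comp_type F = \<alpha>}"
    then show "F \<in> ?h ` ?W" using face_in_image_blocks_of[OF _ u, of F] by auto
  qed
  show ?thesis
    unfolding img[symmetric] sum.reindex[OF inj] using lex by (intro sum.cong) simp_all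
qed

section \<open>The group algebra acting on functions of linear orders\<close>

lemma sym_algebra_apply:
  "\<zero>\<^bsub>sym_algebra n\<^esub> w = 0"
  "\<one>\<^bsub>sym_algebra n\<^esub> w = (if w = id then 1 else 0)"
  "(a \<oplus>\<^bsub>sym_algebra n\<^esub> b) w = a w + b w"
  "(k \<odot>\<^bsub>sym_algebra n\<^esub> a) w = k * a w"
  by (simp_all add: sym_algebra_def sym_group_one)

lemma sym_algebra_finsum_apply:
  fixes g :: "'j \<Rightarrow> (nat \<Rightarrow> nat) \<Rightarrow> 'k::field"
  assumes "finite J" "\<And>j. j \<in> J \<Longrightarrow> g j \<in> carrier (sym_algebra n)"
  shows "finsum (sym_algebra n) g J w = (\<Sum>j\<in>J. g j w)"
proof -
  interpret ring "sym_algebra n :: ('k, _) module" by (rule sym_algebra_ring)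
  show ?thesis
    using assms
  proof (induction J)
    case empty
    then show ?case by (simp add: sym_algebra_apply)
  next
    case (insert j J)
    then have "finsum (sym_algebra n) g (insert j J) = g j \<oplus>\<^bsub>sym_algebra n\<^esub> finsum (sym_algebra n) g J"
      by (intro finsum_insert) auto
    then show ?case using insert by (simp add: sym_algebra_apply)
  qed
qed

text \<open>Under the pairing of coefficients with functions, a product acts with its right factor
  innermost. This makes right multiplication dual to an operator on functions.\<close>

lemma sum_sym_algebra_mult:
  "(\<Sum>s\<in>carrier (sym_group n). (a \<otimes>\<^bsub>sym_algebra n\<^esub> b) s * f s) =
   (\<Sum>u\<in>carrier (sym_group n). a u * (\<Sum>v\<in>carrier (sym_group n). b v * f (u \<circ> v)))"
proof -
  let ?S = "carrier (sym_group n)"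
  have "(\<Sum>s\<in>?S. (a \<otimes>\<^bsub>sym_algebra n\<^esub> b) s * f s) =
      (\<Sum>s\<in>?S. \<Sum>u\<in>?S. \<Sum>v\<in>?S. if s = u \<circ> v then a u * b v * f s else 0)"
    unfolding sym_algebra_mult sum_distrib_right by (intro sum.cong refl) auto
  also have "\<dots> = (\<Sum>u\<in>?S. \<Sum>v\<in>?S. \<Sum>s\<in>?S. if s = u \<circ> v then a u * b v * f s else 0)"
    by (subst sum.swap, rule sum.cong[OF refl], rule sum.swap)
  also have "\<dots> = (\<Sum>u\<in>?S. \<Sum>v\<in>?S. a u * b v * f (u \<circ> v))"
    by (intro sum.cong refl) (simp add: finite_sym_group sym_comp_closed)
  finally show ?thesis by (simp add: sum_distrib_left mult.assoc)
qed

lemma perm_elem_in_carrier: "w \<in> carrier (sym_group n) \<Longrightarrow> perm_elem w \<in> carrier (sym_algebra n)"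
  by (auto simp: sym_algebra_def perm_elem_def)

lemma smult_in_carrier:
  "a \<in> carrier (sym_algebra n) \<Longrightarrow> k \<odot>\<^bsub>sym_algebra n\<^esub> a \<in> carrier (sym_algebra n)"
  by (simp add: sym_algebra_def)

lemma B_comp_in_carrier: "B_comp n \<alpha> \<in> carrier (sym_algebra n :: ('k::field, _) module)"
proof -
  interpret ring "sym_algebra n :: ('k, _) module" by (rule sym_algebra_ring)
  show ?thesis unfolding B_comp_def by (intro finsum_closed) (auto intro: perm_elem_in_carrier)
qed

lemma B_family_in_carrier: "B_family n \<gamma> \<in> carrier (sym_algebra n :: ('k::field, _) module)"
proof -
  interpret ring "sym_algebra n :: ('k, _) module" by (rule sym_algebra_ring)
  show ?thesis
    unfolding B_family_def by (intro finsum_closed) (auto intro: B_comp_in_carrier smult_in_carrier)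
qed

lemma B_comp_apply:
  "(B_comp n \<alpha> w :: 'k::field) = of_bool (w \<in> carrier (sym_group n) \<and> Des n w \<subseteq> partial_sums \<alpha>)"
proof -
  let ?W = "{w \<in> carrier (sym_group n). Des n w \<subseteq> partial_sums \<alpha>}"
  have "(B_comp n \<alpha> w :: 'k) = (\<Sum>v\<in>?W. perm_elem v w)"
    unfolding B_comp_def
    by (rule sym_algebra_finsum_apply) (simp_all add: finite_sym_group perm_elem_in_carrier)
  then show ?thesis by (simp add: perm_elem_def finite_sym_group)
qed

lemma B_family_apply:
  "B_family n \<gamma> w =
    (\<Sum>\<alpha>\<in>compositions n. \<gamma> \<alpha> * of_bool (w \<in> carrier (sym_group n) \<and> Des n w \<subseteq> partial_sums \<alpha>))"
  unfolding B_family_def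
  by (subst sym_algebra_finsum_apply)
     (auto simp: finite_compositions smult_in_carrier B_comp_in_carrier sym_algebra_apply B_comp_apply)

lemma sum_B_family:
  "(\<Sum>w\<in>carrier (sym_group n). B_family n \<gamma> w * f w) =
   (\<Sum>\<alpha>\<in>compositions n. \<gamma> \<alpha> * (\<Sum>w\<in>{w \<in> carrier (sym_group n). Des n w \<subseteq> partial_sums \<alpha>}. f w))"
proof -
  let ?S = "carrier (sym_group n)"
  have "(\<Sum>w\<in>?S. B_family n \<gamma> w * f w) =
      (\<Sum>\<alpha>\<in>compositions n. \<Sum>w\<in>?S. \<gamma> \<alpha> * (if Des n w \<subseteq> partial_sums \<alpha> then f w else 0))"
    unfolding B_family_apply sum_distrib_right
    by (subst sum.swap, intro sum.cong refl) auto
  then show ?thesis by (simp add: sum_distrib_left[symmetric] sum.inter_filter finite_sym_group)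
qed

text \<open>The factor \<open>w0 n\<close> reverses the order of \<open>u\<close>, then the terms of
  each \<open>B_comp\<close> act as the faces of that type. Summing over all types gives
  \<open>T\<close>.\<close>

lemma sum_w0_B_family:
  fixes \<gamma> :: "nat list \<Rightarrow> 'k::linordered_field"
  assumes \<gamma>: "\<And>\<alpha>. \<alpha> \<in> compositions n \<Longrightarrow> 0 \<le> \<gamma> \<alpha>" and u: "u \<in> carrier (sym_group n)"
  shows "(\<Sum>s\<in>carrier (sym_group n).
      (perm_elem (w0 n) \<otimes>\<^bsub>sym_algebra n\<^esub> B_family n \<gamma>) s * f (perm_order n (u \<circ> s))) =
    weighted_preorders.T (set_compositions n) face_order (\<lambda>F. \<gamma> (set_comp_type F)) f (perm_order n u)"
proof -
  interpret weighted_preorders "{1..n}" "set_compositions n" face_order "\<lambda>F. \<gamma> (set_comp_type F)"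
    by (rule weighted_preorders_set_compositions[OF \<gamma>])
  let ?S = "carrier (sym_group n)"
  have uw: "u \<circ> w0 n \<in> ?S" by (intro sym_comp_closed u w0_in_sym_group)
  let ?g = "\<lambda>F. f (lex_order (face_order F) (perm_order n (u \<circ> w0 n)))"
  have "(\<Sum>s\<in>?S. (perm_elem (w0 n) \<otimes>\<^bsub>sym_algebra n\<^esub> B_family n \<gamma>) s * f (perm_order n (u \<circ> s))) =
      (\<Sum>x\<in>?S. if x = w0 n then (\<Sum>w\<in>?S. B_family n \<gamma> w * f (perm_order n (u \<circ> (x \<circ> w)))) else 0)"
    unfolding sum_sym_algebra_mult by (intro sum.cong refl) (simp add: perm_elem_def)
  also have "\<dots> = (\<Sum>w\<in>?S. B_family n \<gamma> w * f (perm_order n (u \<circ> w0 n \<circ> w)))"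
    by (simp add: finite_sym_group w0_in_sym_group comp_assoc)
  also have "\<dots> = (\<Sum>\<alpha>\<in>compositions n. \<gamma> \<alpha> *
      (\<Sum>F\<in>{F \<in> set_compositions n. set_comp_type F = \<alpha>}. ?g F))"
    unfolding sum_B_family by (intro sum.cong refl arg_cong2[where f = "(*)"] sum_faces_of_type[OF _ uw, symmetric])
  also have "\<dots> = (\<Sum>\<alpha>\<in>compositions n.
      \<Sum>F\<in>{F \<in> set_compositions n. set_comp_type F = \<alpha>}. \<gamma> (set_comp_type F) * ?g F)"
    by (simp add: sum_distrib_left)
  also have "\<dots> = (\<Sum>F\<in>set_compositions n. \<gamma> (set_comp_type F) * ?g F)"
    by (rule sum.group)
       (auto simp: finite_set_compositions finite_compositions set_comp_type_in_compositions)
  finally show ?thesis by (simp add: T_def perm_order_w0[OF u])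
qed

section \<open>Transfer from the operator to the minimal polynomial in the group algebra\<close>

theorem theorem10p5:
  fixes n :: nat and \<gamma> :: "nat list \<Rightarrow> 'k::linordered_field"
  assumes "\<And>\<alpha>. \<alpha> \<in> compositions n \<Longrightarrow> 0 \<le> \<gamma> \<alpha>"
  shows "is_minimal_polynomial (sym_algebra n)
           (perm_elem (w0 n) \<otimes>\<^bsub>sym_algebra n\<^esub> B_family n \<gamma>)
           (\<Prod>k\<in>n_tilde_family n \<gamma> ` set_compositions n. [:- k, 1:])"
proof -
  interpret weighted_preorders "{1..n}" "set_compositions n" face_order "\<lambda>F. \<gamma> (set_comp_type F)"
    by (rule weighted_preorders_set_compositions[OF assms])
  interpret A: ring "sym_algebra n :: ('k, _) module" by (rule sym_algebra_ring)
  let ?A = "sym_algebra n :: ('k, _) module" and ?S = "carrier (sym_group n)"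
  define a where "a = perm_elem (w0 n) \<otimes>\<^bsub>?A\<^esub> B_family n \<gamma>"
  define K where "K = n_tilde_family n \<gamma> ` set_compositions n"
  define p where "p = (\<Prod>k\<in>K. [:- k, 1:])"
  have a: "a \<in> carrier ?A"
    unfolding a_def by (intro A.m_closed perm_elem_in_carrier w0_in_sym_group B_family_in_carrier)
  have id: "id \<in> ?S" by (simp add: sym_group_carrier permutes_id)

  \<comment> \<open>In the successor step the last factor \<open>a\<close> acts innermost and
    replaces \<open>f\<close> by \<open>T f\<close>, so the induction generalizes
    \<open>f\<close>.\<close>
  have pow: "(\<Sum>s\<in>?S. (a [^]\<^bsub>?A\<^esub> i) s * f (perm_order n (u \<circ> s))) = (T ^^ i) f (perm_order n u)"
    if u: "u \<in> ?S" for i :: nat and u f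
  proof (induction i arbitrary: f)
    case 0
    have "(\<Sum>s\<in>?S. (a [^]\<^bsub>?A\<^esub> (0::nat)) s * f (perm_order n (u \<circ> s))) =
        (\<Sum>s\<in>?S. if s = id then f (perm_order n (u \<circ> s)) else 0)"
      by (intro sum.cong refl) (simp add: sym_algebra_apply)
    also have "\<dots> = f (perm_order n u)" using id by (simp add: finite_sym_group)
    finally show ?case by (simp add: comp_def)
  next
    case (Suc i)
    have "(\<Sum>s\<in>?S. (a [^]\<^bsub>?A\<^esub> Suc i) s * f (perm_order n (u \<circ> s))) =
        (\<Sum>x\<in>?S. (a [^]\<^bsub>?A\<^esub> i) x * (\<Sum>y\<in>?S. a y * f (perm_order n (u \<circ> x \<circ> y))))"
      by (simp add: A.nat_pow_Suc sum_sym_algebra_mult comp_assoc)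
    also have "\<dots> = (\<Sum>x\<in>?S. (a [^]\<^bsub>?A\<^esub> i) x * T f (perm_order n (u \<circ> x)))"
      unfolding a_def
      by (intro sum.cong refl arg_cong2[where f = "(*)"] sum_w0_B_family[OF assms] sym_comp_closed u)
    also have "\<dots> = (T ^^ i) (T f) (perm_order n u)" by (rule Suc.IH)
    finally show ?case by (simp add: funpow_swap1 comp_def)
  qed

  have eval: "eval_poly_in ?A q a s = (\<Sum>i\<le>degree q. coeff q i * (a [^]\<^bsub>?A\<^esub> i) s)" for q s
    unfolding eval_poly_in_def
    by (subst sym_algebra_finsum_apply) (auto intro!: smult_in_carrier A.nat_pow_closed a simp: sym_algebra_apply)
  have eval_sum: "(\<Sum>s\<in>?S. eval_poly_in ?A q a s * f (perm_order n (u \<circ> s))) =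
      poly_op T q f (perm_order n u)" if u: "u \<in> ?S" for q u f
  proof -
    have "(\<Sum>s\<in>?S. eval_poly_in ?A q a s * f (perm_order n (u \<circ> s))) =
        (\<Sum>i\<le>degree q. coeff q i * (\<Sum>s\<in>?S. (a [^]\<^bsub>?A\<^esub> i) s * f (perm_order n (u \<circ> s))))"
      unfolding eval sum_distrib_right sum_distrib_left by (subst sum.swap) (simp add: mult.assoc)
    then show ?thesis unfolding pow[OF u] poly_op_def .
  qed

  \<comment> \<open>Vanishing in the algebra and vanishing of the operator are equivalent, since the
    permutations give all linear orders and point indicators detect every coefficient.\<close>
  have "eval_poly_in ?A q a = \<zero>\<^bsub>?A\<^esub> \<longleftrightarrow> (\<forall>f. annihilates q f)" for q
  proof
    assume z: "eval_poly_in ?A q a = \<zero>\<^bsub>?A\<^esub>"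
    show "\<forall>f. annihilates q f"
      unfolding annihilates_def
    proof (intro allI impI)
      fix f C assume "linear_order_on {1..n} C"
      then obtain u where u: "u \<in> ?S" "C = perm_order n u" by (rule linear_order_eq_perm_order)
      show "poly_op T q f C = 0"
        using eval_sum[OF u(1), of q f] unfolding u(2) z by (simp add: sym_algebra_apply)
    qed
  next
    assume ann: "\<forall>f. annihilates q f"
    have "eval_poly_in ?A q a s = 0" for s
    proof (cases "s \<in> ?S")
      case True
      \<comment> \<open>Paired with this indicator at the identity, the sum retains only the
        coefficient at \<open>s\<close>, because \<open>perm_order\<close> is injective.\<close>
      let ?f = "\<lambda>C. of_bool (C = perm_order n s) :: 'k"
      have "(\<Sum>t\<in>?S. eval_poly_in ?A q a t * ?f (perm_order n (id \<circ> t))) =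
          (\<Sum>t\<in>?S. if t = s then eval_poly_in ?A q a t else 0)"
        using perm_order_inj[OF _ True] by (intro sum.cong refl) auto
      also have "\<dots> = eval_poly_in ?A q a s" using True by (simp add: finite_sym_group)
      finally show ?thesis
        using eval_sum[OF id, of q ?f] ann linear_order_perm_order[OF id] by (simp add: annihilates_def del: One_nat_def)
    next
      case False
      have "(a [^]\<^bsub>?A\<^esub> i) s = 0" for i :: nat
        using A.nat_pow_closed[OF a, of i] False by (simp add: sym_algebra_def)
      then show ?thesis by (simp add: eval)
    qed
    then show "eval_poly_in ?A q a = \<zero>\<^bsub>?A\<^esub>" by (simp add: sym_algebra_apply fun_eq_iff)
  qed
  note eval_zero_iff = this

  have n_tilde: "n_tilde_family n \<gamma> F = signed_weight (same_block F)" if "F \<in> set_compositions n" for F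
    using n_tilde_family_eq_signed_weight[of n \<gamma>, OF assms that] .
  have K: "K = signed_weight ` {e. equiv {1..n} e}"
  proof (intro equalityI subsetI)
    fix k assume "k \<in> K"
    then obtain F where F: "F \<in> set_compositions n" "k = n_tilde_family n \<gamma> F" by (auto simp: K_def)
    then show "k \<in> signed_weight ` {e. equiv {1..n} e}"
      using n_tilde[OF F(1)] equiv_same_block[OF F(1)] by blast
  next
    fix k assume "k \<in> signed_weight ` {e. equiv {1..n} e}"
    then obtain e where e: "equiv {1..n} e" "k = signed_weight e" by auto
    obtain F where F: "F \<in> set_compositions n" "same_block F = e" by (rule equiv_eq_same_block[OF e(1)])
    show "k \<in> K"
      unfolding K_def e(2) F(2)[symmetric] n_tilde[OF F(1), symmetric] by (rule imageI[OF F(1)])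
  qed
  have finK: "finite K" unfolding K_def using finite_set_compositions by blast
  have deg: "degree p = card K"
    unfolding p_def by (subst degree_prod_eq_sum_degree) auto
  have "lead_coeff p = 1" unfolding p_def by (simp add: lead_coeff_prod)
  moreover have "eval_poly_in ?A p a = \<zero>\<^bsub>?A\<^esub>"
    unfolding eval_zero_iff p_def K using signed_weight_poly_annihilates by blast
  moreover have "degree p \<le> degree q" if q: "q \<noteq> 0" "eval_poly_in ?A q a = \<zero>\<^bsub>?A\<^esub>" for q
  proof -
    \<comment> \<open>Each of the \<open>card K\<close> distinct values is a root of any
      annihilating \<open>q\<close>, which bounds its degree from below.\<close>
    have "K \<subseteq> {x. poly q x = 0}"
      using annihilating_poly_root[of q] q(2) unfolding eval_zero_iff K by auto
    then have "card K \<le> card {x. poly q x = 0}" using poly_roots_finite[OF q(1)] by (intro card_mono)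
    also have "\<dots> \<le> degree q" by (rule card_poly_roots_bound[OF q(1)])
    finally show ?thesis by (simp add: deg)
  qed
  ultimately show ?thesis
    unfolding is_minimal_polynomial_def a_def[symmetric] K_def[symmetric] p_def[symmetric] by blast
qed

end
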